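(* Let $P$ be a Baxter poset on $[n]$. There is a unique twisted Baxter permutation $\sigma=\sigma_1\cdots\sigma_n\in S_n$ that is a linear extension of $P$, and it is constructed by choosing, successively for $i=1,\dots,n$, $\sigma_i=\min(A_i)$ (minimum in numerical order), where $A_i\subseteq[n]$ is the set of all $u\in[n]\setminus\{\sigma_1,\dots,\sigma_{i-1}\}$ such that $\sigma_1\cdots\sigma_{i-1}u$ is a partial linear extension of $P$.
   Context: **Posets.** For a poset $P$ on $[n]=\{1,\dots,n\}$, $<_P$ is its strict order and $<$ the usual numerical order. $x\lessdot_P y$ means $x<_P y$ and there is no $z$ with $x<_P z<_P y$ (a cover relation). $P$ is bounded if it has a least and a greatest element. $(x,y)=\{z: x<_P z<_P y\}$ is the open interval; it is disconnected if it has at least two connected components (as a poset, i.e. its comparability graph is disconnected). A linear extension of $P$ is a permutation $\sigma=\sigma_1\cdots\sigma_n$ of $[n]$ (one-line notation) such that $x<_P y$ implies that $x$ precedes $y$ in $\sigma$. An order ideal of $P$ is a subset $I$ such that $a\in I$ and $b<_P a$ imply $b\in I$. An ordering $a_1\cdots a_i$ of a subset of elements of $P$ is a partial linear extension of $P$ if $\{a_1,\dots,a_j\}$ is an order ideal of $P$ for all $j\in[i]$. **Twisted Baxter permutations.** $\sigma\in S_n$ is a twisted Baxter permutation if it avoids 2-41-3 and 3-41-2, i.e. there are no $i<j<j+1<k$ with $\sigma_{j+1}<\sigma_i<\sigma_k<\sigma_j$ or $\sigma_{j+1}<\sigma_k<\sigma_i<\sigma_j$. **Chains.** For numbers $a<b<c<d$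 in $[n]$: a 2-14-3 chain is $b<_P a\lessdot_P d<_P c$; a 3-14-2 chain is $c<_P a\lessdot_P d<_P b$; a 2-41-3 chain is $b<_P d\lessdot_P a<_P c$; a 3-41-2 chain is $c<_P d\lessdot_P a<_P b$. **Planar embeddings.** A Hasse diagram for $P$ is a drawing in $\mathbb{R}^2$ of the graph of cover relations in which, whenever $x\lessdot_P y$, the point $y$ is above the point $x$ and they are joined by a straight line segment. A planar embedding is a Hasse diagram in which no two edges intersect (except at common endpoints). A finite bounded poset with a planar embedding is a lattice. In a planar embedding of a lattice, let $S(x)$ be the union of all (drawn, maximal) chains containing $x$ and all horizontal line segments whose endpoints lie on these chains. Then $x$ is left of $y$ if $y\notin S(x)$ and the left-pointing horizontal ray starting at $y$ meets $S(x)$. **Baxter posets.** A poset $P$ on $[n]$ is a Baxter poset if: 1. $P$ is bounded. 2. Every $x\in P$ is covered by at most two elements and covers at most two elements. 3. $P$ contains no 2-14-3, no 3-14-2, no 2-41-3 and no 3-41-2 chains. 4. If $[x,y]$ is an interval of $P$ such that $(x,y)$ is disconnected, then $|x-y|=1$. 5. There exists a planar embedding of $P$ such that for every interval $[x,y]$ of $P$ with $(x,y)$ disconnected, if $w,z$ lie in different connected components of $(x,y)$ and $w$ is left of $z$, then $w<x<z$ in numerical order. *)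

theory Defs
  imports "HOL-Analysis.Analysis" "HOL-Combinatorics.Multiset_Permutations"
begin

text \<open>
  A poset on \<open>[n]\<close> is given by its reflexive order relation \<open>P\<close>, with
  \<open>partial_order_on {1..n} P\<close>; in particular \<open>Field P = {1..n}\<close>.  The symbol \<open><\<close>
  always denotes the numerical order on labels.
\<close>

definition poset_less :: "nat rel \<Rightarrow> nat \<Rightarrow> nat \<Rightarrow> bool" where
  "poset_less P x y \<longleftrightarrow> (x, y) \<in> P \<and> x \<noteq> y"

definition poset_covers :: "nat rel \<Rightarrow> nat \<Rightarrow> nat \<Rightarrow> bool" where
  "poset_covers P x y \<longleftrightarrow> poset_less P x y \<and> (\<nexists>z. poset_less P x z \<and> poset_less P z y)"

definition poset_bounded :: "nat rel \<Rightarrow> bool" where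
  "poset_bounded P \<longleftrightarrow>
     (\<exists>b\<in>Field P. \<forall>x\<in>Field P. (b, x) \<in> P) \<and> (\<exists>t\<in>Field P. \<forall>x\<in>Field P. (x, t) \<in> P)"

definition open_interval :: "nat rel \<Rightarrow> nat \<Rightarrow> nat \<Rightarrow> nat set" where
  "open_interval P x y = {z. poset_less P x z \<and> poset_less P z y}"

text \<open>Connected components of the comparability graph of \<open>P\<close> induced on \<open>A\<close>.\<close>

definition poset_components :: "nat rel \<Rightarrow> nat set \<Rightarrow> nat set set" where
  "poset_components P A = A // (Restr (P \<union> P\<inverse>) A)\<^sup>*"

definition poset_disconnected :: "nat rel \<Rightarrow> nat set \<Rightarrow> bool" where
  "poset_disconnected P A \<longleftrightarrow> card (poset_components P A) \<ge> 2"

definition poset_maxchain :: "nat rel \<Rightarrow> nat set \<Rightarrow> bool" where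
  "poset_maxchain P C \<longleftrightarrow> C \<in> Chains P \<and> (\<forall>D\<in>Chains P. C \<subseteq> D \<longrightarrow> D = C)"


text \<open>Linear extensions.  A permutation of \<open>[n]\<close> in one-line notation is an element of
  \<^term>\<open>permutations_of_set {1..n}\<close>; since list positions start at 0,
  \<open>\<sigma>\<^sub>i\<close> is \<open>\<sigma> ! (i - 1)\<close>.\<close>

definition linear_extension :: "nat rel \<Rightarrow> nat list \<Rightarrow> bool" where
  "linear_extension P \<sigma> \<longleftrightarrow>
     \<sigma> \<in> permutations_of_set (Field P) \<and>
     (\<forall>x y. poset_less P x y \<longrightarrow>
        (\<exists>i j. i < j \<and> j < length \<sigma> \<and> \<sigma> ! i = x \<and> \<sigma> ! j = y))"

definition order_ideal :: "nat rel \<Rightarrow> nat set \<Rightarrow> bool" where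
  "order_ideal P I \<longleftrightarrow> I \<subseteq> Field P \<and> (\<forall>a b. a \<in> I \<and> poset_less P b a \<longrightarrow> b \<in> I)"

definition partial_linear_extension :: "nat rel \<Rightarrow> nat list \<Rightarrow> bool" where
  "partial_linear_extension P as \<longleftrightarrow>
     distinct as \<and> set as \<subseteq> Field P \<and>
     (\<forall>j\<in>{1..length as}. order_ideal P (set (take j as)))"

definition twisted_Baxter :: "nat \<Rightarrow> nat list \<Rightarrow> bool" where
  "twisted_Baxter n \<sigma> \<longleftrightarrow>
     \<sigma> \<in> permutations_of_set {1..n} \<and>
     \<not> (\<exists>i j k. i < j \<and> j + 1 < k \<and> k < n \<and>
          (\<sigma> ! (j + 1) < \<sigma> ! i \<and> \<sigma> ! i < \<sigma> ! k \<and> \<sigma> ! k < \<sigma> ! j \<or>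
           \<sigma> ! (j + 1) < \<sigma> ! k \<and> \<sigma> ! k < \<sigma> ! i \<and> \<sigma> ! i < \<sigma> ! j))"

text \<open>The set \<open>A\<^sub>i\<close> of possible continuations, for the prefix \<open>as = \<sigma>\<^sub>1 \<dots> \<sigma>\<^sub>i\<^sub>-\<^sub>1\<close>.\<close>

definition next_candidates :: "nat rel \<Rightarrow> nat list \<Rightarrow> nat set" where
  "next_candidates P as = {u \<in> Field P - set as. partial_linear_extension P (as @ [u])}"

text \<open>\<open>\<sigma>\<close> is the outcome of a run of \<open>n\<close> steps of the greedy construction.  Nonemptiness of
  the candidate set is required because \<^term>\<open>Min {}\<close> is an unspecified number.\<close>

definition greedy_construction :: "nat \<Rightarrow> nat rel \<Rightarrow> nat list \<Rightarrow> bool" where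
  "greedy_construction n P \<sigma> \<longleftrightarrow>
     length \<sigma> = n \<and>
     (\<forall>i\<in>{1..n}. next_candidates P (take (i - 1) \<sigma>) \<noteq> {} \<and>
                  \<sigma> ! (i - 1) = Min (next_candidates P (take (i - 1) \<sigma>)))"


definition chain_2_14_3 :: "nat rel \<Rightarrow> nat \<Rightarrow> nat \<Rightarrow> nat \<Rightarrow> nat \<Rightarrow> bool" where
  "chain_2_14_3 P a b c d \<longleftrightarrow> poset_less P b a \<and> poset_covers P a d \<and> poset_less P d c"

definition chain_3_14_2 :: "nat rel \<Rightarrow> nat \<Rightarrow> nat \<Rightarrow> nat \<Rightarrow> nat \<Rightarrow> bool" where
  "chain_3_14_2 P a b c d \<longleftrightarrow> poset_less P c a \<and> poset_covers P a d \<and> poset_less P d b"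

definition chain_2_41_3 :: "nat rel \<Rightarrow> nat \<Rightarrow> nat \<Rightarrow> nat \<Rightarrow> nat \<Rightarrow> bool" where
  "chain_2_41_3 P a b c d \<longleftrightarrow> poset_less P b d \<and> poset_covers P d a \<and> poset_less P a c"

definition chain_3_41_2 :: "nat rel \<Rightarrow> nat \<Rightarrow> nat \<Rightarrow> nat \<Rightarrow> nat \<Rightarrow> bool" where
  "chain_3_41_2 P a b c d \<longleftrightarrow> poset_less P c d \<and> poset_covers P d a \<and> poset_less P a b"


text \<open>A drawing is determined by the positions \<open>f x\<close> of the elements; the edges are the straight
  segments joining the two ends of a cover relation.\<close>

definition hasse_diagram :: "nat rel \<Rightarrow> (nat \<Rightarrow> real \<times> real) \<Rightarrow> bool" where
  "hasse_diagram P f \<longleftrightarrow>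
     inj_on f (Field P) \<and> (\<forall>x y. poset_covers P x y \<longrightarrow> snd (f x) < snd (f y))"

definition planar_embedding :: "nat rel \<Rightarrow> (nat \<Rightarrow> real \<times> real) \<Rightarrow> bool" where
  "planar_embedding P f \<longleftrightarrow>
     hasse_diagram P f \<and>
     (\<forall>x y u v. poset_covers P x y \<and> poset_covers P u v \<and> (x, y) \<noteq> (u, v) \<longrightarrow>
        closed_segment (f x) (f y) \<inter> closed_segment (f u) (f v) \<subseteq> f ` ({x, y} \<inter> {u, v}))"

definition drawn_chain :: "nat rel \<Rightarrow> (nat \<Rightarrow> real \<times> real) \<Rightarrow> nat set \<Rightarrow> (real \<times> real) set" where
  "drawn_chain P f C =
     f ` C \<union> \<Union>{closed_segment (f u) (f v) | u v. u \<in> C \<and> v \<in> C \<and> poset_covers P u v}"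

definition drawn_chains_through :: "nat rel \<Rightarrow> (nat \<Rightarrow> real \<times> real) \<Rightarrow> nat \<Rightarrow> (real \<times> real) set" where
  "drawn_chains_through P f x = \<Union>{drawn_chain P f C | C. poset_maxchain P C \<and> x \<in> C}"

text \<open>The set \<open>S(x)\<close>.  The two ends of a horizontal segment may lie on different chains: a single
  drawn chain meets each horizontal line in at most one point.\<close>

definition chain_region :: "nat rel \<Rightarrow> (nat \<Rightarrow> real \<times> real) \<Rightarrow> nat \<Rightarrow> (real \<times> real) set" where
  "chain_region P f x =
     drawn_chains_through P f x \<union>
     \<Union>{closed_segment p q | p q. p \<in> drawn_chains_through P f x \<and>
          q \<in> drawn_chains_through P f x \<and> snd p = snd q}"

definition left_of :: "nat rel \<Rightarrow> (nat \<Rightarrow> real \<times> real) \<Rightarrow> nat \<Rightarrow> nat \<Rightarrow> bool" where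
  "left_of P f x y \<longleftrightarrow>
     f y \<notin> chain_region P f x \<and>
     {(t, snd (f y)) | t. t \<le> fst (f y)} \<inter> chain_region P f x \<noteq> {}"


definition Baxter_poset :: "nat \<Rightarrow> nat rel \<Rightarrow> bool" where
  "Baxter_poset n P \<longleftrightarrow>
     partial_order_on {1..n} P \<and>
     poset_bounded P \<and>
     (\<forall>x\<in>{1..n}. card {y. poset_covers P x y} \<le> 2 \<and> card {y. poset_covers P y x} \<le> 2) \<and>
     (\<forall>a\<in>{1..n}. \<forall>b\<in>{1..n}. \<forall>c\<in>{1..n}. \<forall>d\<in>{1..n}. a < b \<and> b < c \<and> c < d \<longrightarrow>
        \<not> chain_2_14_3 P a b c d \<and> \<not> chain_3_14_2 P a b c d \<and>
        \<not> chain_2_41_3 P a b c d \<and> \<not> chain_3_41_2 P a b c d) \<and>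
     (\<forall>x y. (x, y) \<in> P \<and> poset_disconnected P (open_interval P x y) \<longrightarrow>
        \<bar>int x - int y\<bar> = 1) \<and>
     (\<exists>f. planar_embedding P f \<and>
        (\<forall>x y. (x, y) \<in> P \<and> poset_disconnected P (open_interval P x y) \<longrightarrow>
           (\<forall>C\<in>poset_components P (open_interval P x y).
            \<forall>D\<in>poset_components P (open_interval P x y). C \<noteq> D \<longrightarrow>
              (\<forall>w\<in>C. \<forall>z\<in>D. left_of P f w z \<longrightarrow> w < x \<and> x < z))))"

end

theory Submission
  imports Defs
begin

text \<open>
  In a planar drawing a maximal chain is the graph of a continuous function of the height, and two
  such graphs meet only at common vertices or edges. By the intermediate value theorem,
  ``drawn to the left of'' is therefore a strict partial order relating exactly the incomparable
  pairs, and \<open>P\<close> is a lattice. Conditions (2), (4) and (5) give, by induction along the lattice,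
  that if \<open>b\<close> is left of \<open>d\<close>, then the labels of \<open>b \<and> d\<close> and \<open>b \<or> d\<close> lie strictly between those
  of \<open>b\<close> and \<open>d\<close>. So left agrees with numerically smaller on incomparable pairs, and
  ``below in \<open>P\<close> or to the left'' is a total order. Its listing is the greedy one. A linear extension
  deviating from it has an adjacent incomparable descent \<open>d a\<close>, preceded by \<open>a \<and> d\<close> and followed by
  \<open>a \<or> d\<close>, which is a forbidden pattern; conversely a forbidden pattern in the listing yields one
  of the chains excluded by (3).
\<close>

section \<open>Finite posets\<close>

locale finite_poset =
  fixes P :: "nat rel"
  assumes order: "partial_order_on (Field P) P"
    and finite_Field: "finite (Field P)"
begin

abbreviation le (infix "\<sqsubseteq>" 50) where "x \<sqsubseteq> y \<equiv> (x, y) \<in> P"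
abbreviation lt (infix "\<sqsubset>" 50) where "x \<sqsubset> y \<equiv> poset_less P x y"
abbreviation covers (infix "\<lessdot>" 50) where "x \<lessdot> y \<equiv> poset_covers P x y"

lemma le_refl: "x \<in> Field P \<Longrightarrow> x \<sqsubseteq> x"
  using order by (auto simp: partial_order_on_def preorder_on_def refl_on_def)

lemma le_trans: "x \<sqsubseteq> y \<Longrightarrow> y \<sqsubseteq> z \<Longrightarrow> x \<sqsubseteq> z"
  using order by (auto simp: partial_order_on_def preorder_on_def dest: transD)

lemma le_antisym: "x \<sqsubseteq> y \<Longrightarrow> y \<sqsubseteq> x \<Longrightarrow> x = y"
  using order by (auto simp: partial_order_on_def dest: antisymD)

lemma le_Field: "x \<sqsubseteq> y \<Longrightarrow> x \<in> Field P" "x \<sqsubseteq> y \<Longrightarrow> y \<in> Field P"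
  by (auto intro: FieldI1 FieldI2)

lemma lt_Field: "x \<sqsubset> y \<Longrightarrow> x \<in> Field P" "x \<sqsubset> y \<Longrightarrow> y \<in> Field P"
  by (auto simp: poset_less_def intro: le_Field)

lemma lt_imp_le: "x \<sqsubset> y \<Longrightarrow> x \<sqsubseteq> y"
  by (simp add: poset_less_def)

lemma lt_le_trans: "x \<sqsubset> y \<Longrightarrow> y \<sqsubseteq> z \<Longrightarrow> x \<sqsubset> z"
  unfolding poset_less_def using le_trans le_antisym by blast

lemma lt_trans: "x \<sqsubset> y \<Longrightarrow> y \<sqsubset> z \<Longrightarrow> x \<sqsubset> z"
  using lt_le_trans lt_imp_le by blast

lemma lt_not_le: "x \<sqsubset> y \<Longrightarrow> \<not> y \<sqsubseteq> x"
  unfolding poset_less_def using le_antisym by blast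

lemma covers_imp_lt: "x \<lessdot> y \<Longrightarrow> x \<sqsubset> y"
  by (simp add: poset_covers_def)

lemma finite_subset_Field: "S \<subseteq> Field P \<Longrightarrow> finite S"
  using finite_Field finite_subset by blast

lemma exists_maximal:
  assumes "S \<subseteq> Field P" "S \<noteq> {}"
  shows "\<exists>m\<in>S. \<forall>x\<in>S. \<not> m \<sqsubset> x"
proof -
  have "finite S" using assms finite_subset_Field by blast
  then show ?thesis using \<open>S \<noteq> {}\<close>
  proof (induction rule: finite_ne_induct)
    case (singleton x)
    then show ?case by (simp add: poset_less_def)
  next
    case (insert x F)
    from insert.IH obtain m where m: "m \<in> F" "\<forall>y\<in>F. \<not> m \<sqsubset> y" by auto
    show ?case
    proof (cases "m \<sqsubset> x")
      case True
      then have "\<forall>y\<in>insert x F. \<not> x \<sqsubset> y"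
        using m lt_trans[OF True] by (auto simp: poset_less_def[of _ x x])
      then show ?thesis by (rule bexI) simp
    next
      case False
      then show ?thesis using m by (intro bexI[of _ m]) auto
    qed
  qed
qed

text \<open>Order reversal: facts about minimal elements and lower covers follow from their duals by
  instantiating the locale at \<open>P\<inverse>\<close>.\<close>

lemma finite_poset_converse: "finite_poset (P\<inverse>)"
  using order finite_Field by unfold_locales (auto simp: Field_converse)

lemma poset_less_converse: "poset_less (P\<inverse>) x y \<longleftrightarrow> y \<sqsubset> x"
  by (auto simp: poset_less_def)

lemma poset_covers_converse: "poset_covers (P\<inverse>) x y \<longleftrightarrow> y \<lessdot> x"
  by (auto simp: poset_covers_def poset_less_converse)

lemma exists_minimal:
  assumes "S \<subseteq> Field P" "S \<noteq> {}"
  shows "\<exists>m\<in>S. \<forall>x\<in>S. \<not> x \<sqsubset> m"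
  using finite_poset.exists_maximal[OF finite_poset_converse] assms
  by (simp add: poset_less_converse)

lemma upper_cover:
  assumes "x \<sqsubset> y" shows "\<exists>z. x \<lessdot> z \<and> z \<sqsubseteq> y"
proof -
  have "\<exists>m\<in>{z. x \<sqsubset> z \<and> z \<sqsubseteq> y}. \<forall>w\<in>{z. x \<sqsubset> z \<and> z \<sqsubseteq> y}. \<not> w \<sqsubset> m"
  proof (rule exists_minimal)
    show "{z. x \<sqsubset> z \<and> z \<sqsubseteq> y} \<noteq> {}"
      using assms le_refl lt_Field by blast
  qed (auto intro: le_Field)
  then obtain m where m: "x \<sqsubset> m" "m \<sqsubseteq> y" "\<And>w. x \<sqsubset> w \<Longrightarrow> w \<sqsubseteq> y \<Longrightarrow> \<not> w \<sqsubset> m"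
    by blast
  have "x \<lessdot> m"
    unfolding poset_covers_def using m lt_imp_le le_trans by meson
  then show ?thesis using m(2) by blast
qed

lemma lower_cover:
  assumes "x \<sqsubset> y" shows "\<exists>z. x \<sqsubseteq> z \<and> z \<lessdot> y"
  using finite_poset.upper_cover[OF finite_poset_converse, of y x] assms
  by (auto simp: poset_less_converse poset_covers_converse)

section \<open>Maximal chains\<close>

lemma chain_extends:
  assumes "C \<in> Chains P"
  shows "\<exists>D. poset_maxchain P D \<and> C \<subseteq> D"
proof -
  have sub: "D \<subseteq> Field P" if "D \<in> Chains P" for D
    using that by (auto simp: Chains_def intro: le_Field)
  then have fin: "finite {D \<in> Chains P. C \<subseteq> D}"
    using finite_Field by (auto intro: finite_subset[of _ "Pow (Field P)"])
  obtain D where "D \<in> {D \<in> Chains P. C \<subseteq> D}" "\<forall>E\<in>{D \<in> Chains P. C \<subseteq> D}. D \<subseteq> E \<longrightarrow> D = E"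
    using finite_has_maximal[OF fin] assms by blast
  then show ?thesis unfolding poset_maxchain_def by blast
qed

lemma comparable_maxchain:
  assumes "x \<sqsubseteq> y \<or> y \<sqsubseteq> x" shows "\<exists>C. poset_maxchain P C \<and> x \<in> C \<and> y \<in> C"
proof -
  have "{x, y} \<in> Chains P"
    using assms le_refl le_Field by (auto simp: Chains_def)
  then show ?thesis using chain_extends by blast
qed

lemma maxchain_containing: "x \<in> Field P \<Longrightarrow> \<exists>C. poset_maxchain P C \<and> x \<in> C"
  using comparable_maxchain le_refl by blast

lemma maxchain_comparable:
  "poset_maxchain P C \<Longrightarrow> x \<in> C \<Longrightarrow> y \<in> C \<Longrightarrow> x \<sqsubseteq> y \<or> y \<sqsubseteq> x"
  by (auto simp: poset_maxchain_def Chains_def)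

lemma maxchain_Field: "poset_maxchain P C \<Longrightarrow> C \<subseteq> Field P"
  by (auto simp: poset_maxchain_def Chains_def intro: le_Field)

lemma maxchain_memberI:
  assumes C: "poset_maxchain P C" and x: "x \<in> Field P"
    and comp: "\<And>y. y \<in> C \<Longrightarrow> x \<sqsubseteq> y \<or> y \<sqsubseteq> x"
  shows "x \<in> C"
proof -
  have "insert x C \<in> Chains P"
    using C comp le_refl[OF x] by (auto simp: poset_maxchain_def Chains_def)
  then show ?thesis using C unfolding poset_maxchain_def by blast
qed

text \<open>Otherwise \<open>x\<close> would lie strictly inside the cover. Consequently a drawn
  chain has no vertex at a height strictly inside one of its edges.\<close>

lemma maxchain_cover_cases:
  assumes C: "poset_maxchain P C" and "u \<in> C" "v \<in> C" "u \<lessdot> v" "x \<in> C"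
  shows "x \<sqsubseteq> u \<or> v \<sqsubseteq> x"
proof (rule ccontr)
  assume "\<not> ?thesis"
  then have "u \<sqsubset> x \<and> x \<sqsubset> v"
    using maxchain_comparable[OF C] assms by (metis poset_less_def le_refl maxchain_Field subsetD)
  then show False using assms by (auto simp: poset_covers_def)
qed

text \<open>The least element of \<open>C\<close> above \<open>c\<close> covers it in all of
  \<open>P\<close>: anything strictly between would be comparable with every element of
  \<open>C\<close>, so maximality would put it into \<open>C\<close>. Hence a drawn maximal chain
  has no gaps.\<close>

lemma maxchain_upper_cover:
  assumes C: "poset_maxchain P C" and "c \<in> C" "d \<in> C" "c \<sqsubset> d"
  shows "\<exists>v\<in>C. c \<lessdot> v"
proof -
  have "\<exists>m\<in>{z\<in>C. c \<sqsubset> z}. \<forall>w\<in>{z\<in>C. c \<sqsubset> z}. \<not> w \<sqsubset> m"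
    by (rule exists_minimal) (use assms maxchain_Field in auto)
  then obtain m where m: "m \<in> C" "c \<sqsubset> m" "\<And>w. w \<in> C \<Longrightarrow> c \<sqsubset> w \<Longrightarrow> \<not> w \<sqsubset> m"
    by blast
  have "\<not> (c \<sqsubset> z \<and> z \<sqsubset> m)" for z
  proof
    assume z: "c \<sqsubset> z \<and> z \<sqsubset> m"
    have "z \<in> C"
    proof (rule maxchain_memberI[OF C])
      show "z \<in> Field P" using z lt_Field by blast
      fix y assume y: "y \<in> C"
      then have "y \<sqsubseteq> c \<or> c \<sqsubset> y"
        using maxchain_comparable[OF C \<open>c \<in> C\<close> y] le_refl by (metis poset_less_def)
      moreover have "m \<sqsubseteq> y" if "c \<sqsubset> y"
        using m y that maxchain_comparable[OF C y m(1)] le_refl by (metis poset_less_def)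
      ultimately show "z \<sqsubseteq> y \<or> y \<sqsubseteq> z"
        using z lt_imp_le le_trans by meson
    qed
    then show False using m z by blast
  qed
  then show ?thesis using m unfolding poset_covers_def by blast
qed

end

section \<open>Planar drawings\<close>

lemma segment_height_inj:
  assumes "p \<in> closed_segment a b" "q \<in> closed_segment a b" "snd a < snd (b :: real \<times> real)"
    "snd p = snd q"
  shows "p = q"
proof -
  obtain s t where s: "p = (1 - s) *\<^sub>R a + s *\<^sub>R b" and t: "q = (1 - t) *\<^sub>R a + t *\<^sub>R b"
    using assms by (auto simp: in_segment)
  have "(s - t) * (snd b - snd a) = 0" using assms(4) unfolding s t by (simp add: algebra_simps)
  then show ?thesis using assms s t by simp
qed

text \<open>The bounds make every maximal chain run from \<open>bot\<close> to \<open>top\<close>,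
  so that all drawn maximal chains cover the same range of heights.\<close>

locale drawn_poset = finite_poset +
  fixes f :: "nat \<Rightarrow> real \<times> real" and bot top :: nat
  assumes bot: "bot \<in> Field P" "\<And>x. x \<in> Field P \<Longrightarrow> bot \<sqsubseteq> x"
    and top: "top \<in> Field P" "\<And>x. x \<in> Field P \<Longrightarrow> x \<sqsubseteq> top"
    and planar: "planar_embedding P f"
begin

abbreviation height :: "nat \<Rightarrow> real" where "height x \<equiv> snd (f x)"

lemma inj_f: "x \<in> Field P \<Longrightarrow> y \<in> Field P \<Longrightarrow> f x = f y \<Longrightarrow> x = y"
  using planar by (auto simp: planar_embedding_def hasse_diagram_def dest: inj_onD)

lemma cover_height: "x \<lessdot> y \<Longrightarrow> height x < height y"
  using planar by (auto simp: planar_embedding_def hasse_diagram_def)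

lemma segments_meet:
  "x \<lessdot> y \<Longrightarrow> u \<lessdot> v \<Longrightarrow> p \<in> closed_segment (f x) (f y) \<Longrightarrow> p \<in> closed_segment (f u) (f v) \<Longrightarrow>
   (x, y) = (u, v) \<or> (\<exists>w\<in>{x, y} \<inter> {u, v}. p = f w)"
  using planar unfolding planar_embedding_def by (smt (verit) IntI imageE subsetD)

text \<open>The drawing prescribes rising heights for covers only; climbing from \<open>x\<close> by
  one cover shrinks the open interval below \<open>y\<close>.\<close>

lemma lt_height: "x \<sqsubset> y \<Longrightarrow> height x < height y"
proof (induction "card (open_interval P x y)" arbitrary: x rule: less_induct)
  case less
  obtain z where z: "x \<lessdot> z" "z \<sqsubseteq> y" using upper_cover less.prems by blast
  show ?case
  proof (cases "z = y")
    case True then show ?thesis using z cover_height by blast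
  next
    case False
    then have zy: "z \<sqsubset> y" using z by (simp add: poset_less_def)
    have xz: "x \<sqsubset> z" using z covers_imp_lt by blast
    have "open_interval P z y \<subseteq> open_interval P x y"
      using lt_trans[OF xz] by (auto simp: open_interval_def)
    moreover have "z \<in> open_interval P x y - open_interval P z y"
      using xz zy by (auto simp: open_interval_def poset_less_def)
    ultimately have "open_interval P z y \<subset> open_interval P x y" by blast
    moreover have "finite (open_interval P x y)"
      by (rule finite_subset_Field) (auto simp: open_interval_def intro: lt_Field)
    ultimately have "card (open_interval P z y) < card (open_interval P x y)"
      by (rule psubset_card_mono[rotated])
    then show ?thesis using less.hyps zy cover_height[OF z(1)] by fastforce
  qed
qed

lemma le_height: "x \<sqsubseteq> y \<Longrightarrow> height x \<le> height y"
  using lt_height by (fastforce simp: poset_less_def)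

section \<open>Drawn maximal chains as continuous functions of the height\<close>

lemma maxchain_bot: "poset_maxchain P C \<Longrightarrow> bot \<in> C"
  using maxchain_memberI bot maxchain_Field by blast

lemma maxchain_top: "poset_maxchain P C \<Longrightarrow> top \<in> C"
  using maxchain_memberI top maxchain_Field by blast

lemma maxchain_le_iff:
  assumes "poset_maxchain P C" "x \<in> C" "y \<in> C"
  shows "x \<sqsubseteq> y \<longleftrightarrow> height x \<le> height y"
proof -
  consider "x \<sqsubset> y" | "y \<sqsubset> x" | "x = y"
    using maxchain_comparable[OF assms] by (auto simp: poset_less_def)
  then show ?thesis
    using lt_height lt_imp_le lt_not_le le_refl maxchain_Field assms by cases fastforce+
qed

text \<open>Ends of edges are counted as vertices, so that the edge case comes with strict height
  bounds; these exclude vertices of the chain at the same height.\<close>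

lemma drawn_chain_cases:
  assumes C: "poset_maxchain P C" and p: "p \<in> drawn_chain P f C"
  obtains c where "c \<in> C" "p = f c"
  | u v where "u \<in> C" "v \<in> C" "u \<lessdot> v" "p \<in> closed_segment (f u) (f v)"
      "height u < snd p" "snd p < height v"
proof -
  consider (1) c where "c \<in> C" "p = f c"
    | (2) u v where "u \<in> C" "v \<in> C" "u \<lessdot> v" "p \<in> closed_segment (f u) (f v)"
    using p by (auto simp: drawn_chain_def)
  then show ?thesis
  proof cases
    case 2
    then obtain t where t: "0 \<le> t" "t \<le> 1" "p = (1 - t) *\<^sub>R f u + t *\<^sub>R f v"
      by (auto simp: in_segment)
    show ?thesis
    proof (cases "t = 0 \<or> t = 1")
      case True then show ?thesis using t 2 that(1) by auto
    next
      case False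
      have "height u < height v" using 2 cover_height by blast
      moreover have "snd p = height u + t * (height v - height u)"
        "snd p = height v - (1 - t) * (height v - height u)"
        unfolding t(3) by (simp_all add: algebra_simps)
      moreover have "0 < t * (height v - height u)" "0 < (1 - t) * (height v - height u)"
        using False t(1,2) \<open>height u < height v\<close> by auto
      ultimately have "height u < snd p" "snd p < height v" by linarith+
      then show ?thesis using 2 that(2) by blast
    qed
  qed (use that in auto)
qed

lemma edges_same_height:
  assumes C: "poset_maxchain P C" and "u \<in> C" "v \<in> C" "u \<lessdot> v" "u' \<in> C" "v' \<in> C" "u' \<lessdot> v'"
    and t: "height u < t" "t < height v" "height u' < t" "t < height v'"
  shows "u = u' \<and> v = v'"
proof -
  have "u' \<sqsubseteq> u" "u \<sqsubseteq> u'" "v \<sqsubseteq> v'" "v' \<sqsubseteq> v"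
    using maxchain_cover_cases[OF C] le_height assms by fastforce+
  then show ?thesis using le_antisym by blast
qed

text \<open>Vertices of a chain are ordered by height, no vertex sits at a height inside an edge,
  and two edges passing a common height coincide; on a single rising edge the height determines the
  point.\<close>

lemma drawn_chain_unique:
  assumes C: "poset_maxchain P C" and p: "p \<in> drawn_chain P f C" and q: "q \<in> drawn_chain P f C"
    and eq: "snd p = snd q"
  shows "p = q"
proof -
  have no: False if "c \<in> C" "u \<in> C" "v \<in> C" "u \<lessdot> v" "height u < height c" "height c < height v"
    for c u v
    using maxchain_cover_cases[OF C that(2-4,1)] le_height that by fastforce
  show ?thesis
    using C p
  proof (cases rule: drawn_chain_cases)
    case (1 c)
    note p1 = this
    show ?thesis using C q
    proof (cases rule: drawn_chain_cases)
      case (1 d)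
      then have "c = d"
        using p1 eq by (intro le_antisym) (simp_all add: maxchain_le_iff[OF C])
      then show ?thesis using 1 p1 by simp
    next
      case (2 u v)
      then show ?thesis using no[of c u v] p1 eq by simp
    qed
  next
    case (2 u v)
    note p2 = this
    show ?thesis using C q
    proof (cases rule: drawn_chain_cases)
      case (1 d)
      then show ?thesis using no[of d u v] p2 eq by simp
    next
      case (2 u' v')
      then have "u = u' \<and> v = v'"
        using edges_same_height[OF C p2(1-3) 2(1-3) p2(5,6)] 2(5,6) eq by simp
      then have "q \<in> closed_segment (f u) (f v)" using 2(4) by simp
      then show ?thesis
        by (rule segment_height_inj[OF p2(4) _ cover_height[OF p2(3)] eq])
    qed
  qed
qed

text \<open>The highest vertex of \<open>C\<close> not above height \<open>t\<close> either has that
  height or starts an edge of \<open>C\<close> that passes it.\<close>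

lemma drawn_chain_exists:
  assumes C: "poset_maxchain P C" and t: "t \<in> {height bot..height top}"
  shows "\<exists>s. (s, t) \<in> drawn_chain P f C"
proof -
  have "\<exists>m\<in>{c\<in>C. height c \<le> t}. \<forall>x\<in>{c\<in>C. height c \<le> t}. \<not> m \<sqsubset> x"
    by (rule exists_maximal) (use t C maxchain_bot maxchain_Field in auto)
  then obtain u where u: "u \<in> C" "height u \<le> t" and umax: "\<And>x. x \<in> C \<Longrightarrow> height x \<le> t \<Longrightarrow> \<not> u \<sqsubset> x"
    by blast
  show ?thesis
  proof (cases "height u = t")
    case True
    then show ?thesis using u by (intro exI[of _ "fst (f u)"]) (auto simp: drawn_chain_def)
  next
    case False
    then have "u \<noteq> top" using u t by auto
    then have "u \<sqsubset> top" using top u C maxchain_Field by (auto simp: poset_less_def)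
    then obtain v where v: "v \<in> C" "u \<lessdot> v"
      using maxchain_upper_cover[OF C u(1) maxchain_top[OF C]] by blast
    have hv: "t < height v" using umax v covers_imp_lt by force
    \<comment> \<open>The parameter at which the segment from \<open>f u\<close> to
      \<open>f v\<close> reaches height \<open>t\<close>.\<close>
    define r where "r = (t - height u) / (height v - height u)"
    have d: "height v - height u > 0" using v cover_height by force
    have r: "0 \<le> r" "r \<le> 1" using u hv d by (auto simp: r_def)
    have "height u + r * (height v - height u) = t" using d by (simp add: r_def)
    then have "snd ((1 - r) *\<^sub>R f u + r *\<^sub>R f v) = t" by (simp add: algebra_simps)
    moreover have "(1 - r) *\<^sub>R f u + r *\<^sub>R f v \<in> closed_segment (f u) (f v)"
      using r by (auto simp: in_segment)
    then have "(1 - r) *\<^sub>R f u + r *\<^sub>R f v \<in> drawn_chain P f C"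
      using u v by (auto simp: drawn_chain_def)
    ultimately show ?thesis by (metis prod.collapse)
  qed
qed

text \<open>Horizontal coordinate at which the drawn chain passes height \<open>t\<close>. For a
  maximal chain it is determined between the heights of \<open>bot\<close> and \<open>top\<close>;
  outside that range the value is arbitrary.\<close>

definition chain_at :: "nat set \<Rightarrow> real \<Rightarrow> real" where
  "chain_at C t = (THE s. (s, t) \<in> drawn_chain P f C)"

lemma chain_at_eq: "poset_maxchain P C \<Longrightarrow> (s, t) \<in> drawn_chain P f C \<Longrightarrow> chain_at C t = s"
  unfolding chain_at_def using drawn_chain_unique by (intro the_equality) force+

lemma chain_at_drawn:
  "poset_maxchain P C \<Longrightarrow> t \<in> {height bot..height top} \<Longrightarrow> (chain_at C t, t) \<in> drawn_chain P f C"
  using chain_at_eq drawn_chain_exists by metis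

lemma chain_at_vertex: "poset_maxchain P C \<Longrightarrow> x \<in> C \<Longrightarrow> chain_at C (height x) = fst (f x)"
  by (rule chain_at_eq) (auto simp: drawn_chain_def)

lemma height_range: "x \<in> Field P \<Longrightarrow> height x \<in> {height bot..height top}"
  using bot top le_height by auto

lemma drawn_chain_height:
  assumes C: "poset_maxchain P C" and "p \<in> drawn_chain P f C"
  shows "snd p \<in> {height bot..height top}"
  using assms
proof (cases rule: drawn_chain_cases)
  case (2 u v)
  then have "u \<in> Field P" "v \<in> Field P" using C maxchain_Field by auto
  then show ?thesis using 2 height_range[of u] height_range[of v] by auto
qed (use C maxchain_Field height_range in auto)

lemma compact_drawn_chain:
  assumes C: "poset_maxchain P C"
  shows "compact (drawn_chain P f C)"
proof -
  have fin: "finite C" using C maxchain_Field finite_subset_Field by blast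
  have eq: "{closed_segment (f u) (f v) | u v. u \<in> C \<and> v \<in> C \<and> u \<lessdot> v} =
      (\<lambda>(u, v). closed_segment (f u) (f v)) ` {(u, v) \<in> C \<times> C. u \<lessdot> v}" by auto
  have "finite {closed_segment (f u) (f v) | u v. u \<in> C \<and> v \<in> C \<and> u \<lessdot> v}"
    unfolding eq by (rule finite_imageI, rule finite_subset[of _ "C \<times> C"]) (use fin in auto)
  then have "compact (\<Union>{closed_segment (f u) (f v) | u v. u \<in> C \<and> v \<in> C \<and> u \<lessdot> v})"
    by (intro compact_Union) auto
  then show ?thesis
    unfolding drawn_chain_def using fin by (simp add: compact_Un finite_imp_compact)
qed

text \<open>The drawn chain is compact and, with coordinates swapped, it is the graph of
  \<open>chain_at C\<close>; a function into a compact set with closed graph is continuous.\<close>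

lemma continuous_chain_at:
  assumes C: "poset_maxchain P C"
  shows "continuous_on {height bot..height top} (chain_at C)"
proof (rule continuous_from_closed_graph)
  have D: "compact (drawn_chain P f C)" by (rule compact_drawn_chain[OF C])
  show "compact (fst ` drawn_chain P f C)"
    by (rule compact_continuous_image[OF _ D]) (intro continuous_intros)
  show "chain_at C \<in> {height bot..height top} \<rightarrow> fst ` drawn_chain P f C"
    using chain_at_drawn[OF C] by force
  have "(\<lambda>t. (t, chain_at C t)) ` {height bot..height top} = prod.swap ` drawn_chain P f C"
  proof (intro equalityI subsetI)
    fix p assume "p \<in> prod.swap ` drawn_chain P f C"
    then obtain s t where p: "p = (t, s)" "(s, t) \<in> drawn_chain P f C" by auto
    then show "p \<in> (\<lambda>t. (t, chain_at C t)) ` {height bot..height top}"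
      using chain_at_eq[OF C] drawn_chain_height[OF C p(2)] by auto
  qed (use chain_at_drawn[OF C] in force)
  moreover have "compact (prod.swap ` drawn_chain P f C)"
    by (rule compact_continuous_image[OF _ D]) (rule continuous_on_swap)
  ultimately show "closed ((\<lambda>t. (t, chain_at C t)) ` {height bot..height top})"
    by (simp add: compact_imp_closed)
qed

text \<open>Planarity speaks about pairs of edges, so \<open>z\<close> is first viewed as an end of
  an edge of its own.\<close>

lemma vertex_on_edge:
  assumes uv: "u \<lessdot> v" and z: "z \<in> Field P" "f z \<in> closed_segment (f u) (f v)"
  shows "z = u \<or> z = v"
proof -
  have *: "z = u \<or> z = v" if xy: "x \<lessdot> y" and zxy: "z = x \<or> z = y" for x y
  proof -
    have "f z \<in> closed_segment (f x) (f y)" using zxy by auto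
    then consider "(u, v) = (x, y)" | w where "w \<in> {u, v} \<inter> {x, y}" "f z = f w"
      using segments_meet[OF uv xy z(2)] by blast
    then show ?thesis
    proof cases
      case 2
      then have "w \<in> Field P" using uv covers_imp_lt lt_Field by blast
      then show ?thesis using 2 inj_f z by blast
    qed (use zxy in auto)
  qed
  \<comment> \<open>A poset with a cover has more than one element, so \<open>z\<close> is joined to
    some neighbour above or below.\<close>
  have "z \<noteq> bot \<or> z \<noteq> top"
    using uv covers_imp_lt lt_not_le lt_Field bot top le_trans by metis
  then consider "bot \<sqsubset> z" | "z \<sqsubset> top" using bot top z by (auto simp: poset_less_def)
  then show ?thesis using upper_cover lower_cover * by cases metis+
qed

text \<open>By planarity two chains can only meet at a common vertex or along a common edge, so the last
  common vertex before a meeting point lies above everything drawn lower on either chain.\<close>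

lemma chains_meet:
  assumes C: "poset_maxchain P C" and D: "poset_maxchain P D"
    and t: "t \<in> {height bot..height top}" and eq: "chain_at C t = chain_at D t"
  shows "\<exists>s\<in>C \<inter> D. height s \<le> t \<and> (\<forall>x\<in>C \<union> D. height x \<le> t \<longrightarrow> x \<sqsubseteq> s)"
proof -
  define p where "p = (chain_at C t, t)"
  have pC: "p \<in> drawn_chain P f C" and pD: "p \<in> drawn_chain P f D"
    using chain_at_drawn[OF C t] chain_at_drawn[OF D t] eq by (auto simp: p_def)
  have "(\<exists>c\<in>C \<inter> D. p = f c) \<or> (\<exists>u\<in>C \<inter> D. \<exists>v\<in>C \<inter> D. u \<lessdot> v \<and> height u < t \<and> t < height v)"
    using C pC
  proof (cases rule: drawn_chain_cases)
    case (1 c)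
    then have c: "c \<in> Field P" using C maxchain_Field by blast
    show ?thesis using D pD
    proof (cases rule: drawn_chain_cases)
      case (1 d)
      then have "d = c" using \<open>p = f c\<close> c inj_f D maxchain_Field by blast
      then show ?thesis using 1 \<open>c \<in> C\<close> by blast
    next
      case (2 u v)
      then show ?thesis using 1 c vertex_on_edge by blast
    qed
  next
    case (2 u v)
    note pC2 = this
    show ?thesis using D pD
    proof (cases rule: drawn_chain_cases)
      case (1 d)
      then have "d \<in> Field P" using D maxchain_Field by blast
      then show ?thesis using 1 2 vertex_on_edge by blast
    next
      case (2 u' v')
      then show ?thesis using segments_meet[OF pC2(3) 2(3) pC2(4) 2(4)] pC2 by (auto simp: p_def)
    qed
  qed
  then show ?thesis
  proof (elim disjE bexE conjE)
    fix c assume c: "c \<in> C \<inter> D" "p = f c"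
    then have "height c = t" by (metis p_def snd_conv)
    then show ?thesis
      using c maxchain_le_iff[OF C] maxchain_le_iff[OF D] by (intro bexI[of _ c]) auto
  next
    fix u v assume uv: "u \<in> C \<inter> D" "v \<in> C \<inter> D" "u \<lessdot> v" "height u < t" "t < height v"
    have "x \<sqsubseteq> u" if "x \<in> C \<union> D" "height x \<le> t" for x
      using maxchain_cover_cases[OF C, of u v x] maxchain_cover_cases[OF D, of u v x] uv that le_height
      by fastforce
    then show ?thesis using uv by (intro bexI[of _ u]) auto
  qed
qed

text \<open>Intermediate value theorem for the difference of the two chains; a closed segment is
  used because \<open>a\<close> and \<open>b\<close> may come in either order.\<close>

lemma chain_at_crossing:
  assumes C: "poset_maxchain P C" and D: "poset_maxchain P D"
    and "a \<in> {height bot..height top}" "b \<in> {height bot..height top}"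
    and "chain_at C a \<le> chain_at D a" "chain_at D b \<le> chain_at C b"
  shows "\<exists>t\<in>closed_segment a b. chain_at C t = chain_at D t"
proof -
  let ?g = "\<lambda>t. chain_at C t - chain_at D t"
  have sub: "closed_segment a b \<subseteq> {height bot..height top}"
    using assms by (auto simp: closed_segment_eq_real_ivl split: if_splits)
  then have "continuous_on (closed_segment a b) ?g"
    by (intro continuous_intros continuous_on_subset[OF continuous_chain_at[OF C]]
        continuous_on_subset[OF continuous_chain_at[OF D]])
  then have "connected (?g ` closed_segment a b)"
    by (rule connected_continuous_image) (rule connected_segment)
  then have "0 \<in> ?g ` closed_segment a b"
    using connectedD_interval[of "?g ` closed_segment a b" "?g a" "?g b" 0] assms by auto
  then show ?thesis by auto
qed

section \<open>The left-to-right order of a planar drawing\<close>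

text \<open>Quantifying over all chains through the two elements and all heights between them allows
  the relation to be applied with whichever chains are convenient. \<open>left_total\<close> shows
  that for incomparable elements the choice does not matter.\<close>

definition left :: "nat \<Rightarrow> nat \<Rightarrow> bool" where
  "left x y \<longleftrightarrow> x \<in> Field P \<and> y \<in> Field P \<and>
     (\<forall>C D t. poset_maxchain P C \<and> poset_maxchain P D \<and> x \<in> C \<and> y \<in> D \<and>
        t \<in> closed_segment (height x) (height y) \<longrightarrow> chain_at C t < chain_at D t)"

lemma closed_segment_heights:
  "x \<in> Field P \<Longrightarrow> y \<in> Field P \<Longrightarrow> t \<in> closed_segment (height x) (height y) \<Longrightarrow>
   t \<in> {height bot..height top}"
  using height_range[of x] height_range[of y]
  by (auto simp: closed_segment_eq_real_ivl split: if_splits)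

text \<open>At a meeting point, \<open>chains_meet\<close> supplies a common vertex. It is above the
  lower drawn of the two elements and, lying on the chain of the higher one, below that one, so the
  two would be comparable.\<close>

lemma chains_disjoint_between:
  assumes C: "poset_maxchain P C" and D: "poset_maxchain P D" and x: "x \<in> C" and y: "y \<in> D"
    and "\<not> x \<sqsubseteq> y" "\<not> y \<sqsubseteq> x" and t: "t \<in> closed_segment (height x) (height y)"
  shows "chain_at C t \<noteq> chain_at D t"
proof
  assume eq: "chain_at C t = chain_at D t"
  have "x \<in> Field P" "y \<in> Field P" using C D x y maxchain_Field by auto
  then have "t \<in> {height bot..height top}" using t closed_segment_heights by blast
  then obtain s where s: "s \<in> C" "s \<in> D" "height s \<le> t"
    and below: "\<And>z. z \<in> C \<union> D \<Longrightarrow> height z \<le> t \<Longrightarrow> z \<sqsubseteq> s"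
    using chains_meet[OF C D _ eq] by blast
  consider "height x \<le> t" "t \<le> height y" | "height y \<le> t" "t \<le> height x"
    using t by (auto simp: closed_segment_eq_real_ivl split: if_splits)
  then show False
  proof cases
    case 1
    then have "x \<sqsubseteq> s" "s \<sqsubseteq> y" using below x s y maxchain_le_iff[OF D] by auto
    then show False using assms le_trans by blast
  next
    case 2
    then have "y \<sqsubseteq> s" "s \<sqsubseteq> x" using below x s y maxchain_le_iff[OF C] by auto
    then show False using assms le_trans by blast
  qed
qed

text \<open>Chains through the two incomparable elements never meet between their heights, so by
  continuity they keep their sides. All chains through \<open>x\<close> agree at the height of
  \<open>x\<close>, and likewise for \<open>y\<close>, so the side is the same for every pair of
  chains.\<close>

lemma left_total:
  assumes "x \<in> Field P" "y \<in> Field P" "\<not> x \<sqsubseteq> y" "\<not> y \<sqsubseteq> x"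
  shows "left x y \<or> left y x"
proof -
  have side: "chain_at C t < chain_at D t \<longleftrightarrow> chain_at C u < chain_at D u"
    if "poset_maxchain P C" "poset_maxchain P D" "x \<in> C" "y \<in> D"
      and t: "t \<in> closed_segment (height x) (height y)" and u: "u \<in> closed_segment (height x) (height y)"
    for C D t u
  proof -
    have seg: "closed_segment t u \<subseteq> closed_segment (height x) (height y)"
      "closed_segment u t \<subseteq> closed_segment (height x) (height y)"
      using t u by (simp_all add: subset_closed_segment)
    have r: "t \<in> {height bot..height top}" "u \<in> {height bot..height top}"
      using t u assms closed_segment_heights by blast+
    show ?thesis
      using chain_at_crossing[OF that(1,2) r] chain_at_crossing[OF that(1,2) r(2,1)]
        chains_disjoint_between[OF that(1-4) assms(3,4)] seg by (meson linorder_le_cases not_le subsetD)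
  qed
  obtain C0 where C0: "poset_maxchain P C0" "x \<in> C0" using maxchain_containing assms by blast
  obtain D0 where D0: "poset_maxchain P D0" "y \<in> D0" using maxchain_containing assms by blast
  have ends: "height x \<in> closed_segment (height x) (height y)" "height y \<in> closed_segment (height x) (height y)"
    by simp_all
  have all: "chain_at C t < chain_at D t \<longleftrightarrow> chain_at C0 (height y) < chain_at D0 (height y)"
    if "poset_maxchain P C" "poset_maxchain P D" "x \<in> C" "y \<in> D"
      "t \<in> closed_segment (height x) (height y)" for C D t
  proof -
    \<comment> \<open>\<open>C\<close> is exchanged for \<open>C0\<close> at the height of
      \<open>x\<close>, then \<open>D\<close> for \<open>D0\<close> at the height of
      \<open>y\<close>.\<close>
    have "chain_at C t < chain_at D t \<longleftrightarrow> chain_at C (height x) < chain_at D (height x)"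
      using side that ends by blast
    also have "\<dots> \<longleftrightarrow> chain_at C0 (height x) < chain_at D (height x)"
      using chain_at_vertex that C0 by simp
    also have "\<dots> \<longleftrightarrow> chain_at C0 (height y) < chain_at D (height y)"
      using side that ends C0 by blast
    also have "\<dots> \<longleftrightarrow> chain_at C0 (height y) < chain_at D0 (height y)"
      using chain_at_vertex that D0 by simp
    finally show ?thesis .
  qed
  show ?thesis
  proof (cases "chain_at C0 (height y) < chain_at D0 (height y)")
    case True
    then show ?thesis unfolding left_def using all assms by blast
  next
    case False
    then have "chain_at D t < chain_at C t"
      if "poset_maxchain P C" "poset_maxchain P D" "x \<in> C" "y \<in> D"
        "t \<in> closed_segment (height x) (height y)" for C D t
      using all[OF that] chains_disjoint_between[OF that(1-4) assms(3,4) that(5)] by linarith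
    then show ?thesis unfolding left_def using assms closed_segment_commute by metis
  qed
qed

lemma left_Field: "left x y \<Longrightarrow> x \<in> Field P" "left x y \<Longrightarrow> y \<in> Field P"
  by (auto simp: left_def)

lemma leftD:
  "left x y \<Longrightarrow> poset_maxchain P C \<Longrightarrow> poset_maxchain P D \<Longrightarrow> x \<in> C \<Longrightarrow> y \<in> D \<Longrightarrow>
   t \<in> closed_segment (height x) (height y) \<Longrightarrow> chain_at C t < chain_at D t"
  unfolding left_def by blast

text \<open>Comparable elements share a maximal chain, which is not strictly left of itself.\<close>

lemma left_incomparable:
  assumes "left x y" shows "\<not> x \<sqsubseteq> y" "\<not> y \<sqsubseteq> x"
proof -
  have "\<not> (x \<in> C \<and> y \<in> C)" if "poset_maxchain P C" for C
    using leftD[OF assms that that, of "height x"] by auto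
  then show "\<not> x \<sqsubseteq> y" "\<not> y \<sqsubseteq> x" using comparable_maxchain by blast+
qed

text \<open>On a chain shared by \<open>x\<close> and \<open>z\<close>, a chain through
  \<open>y\<close> would be to the right at \<open>x\<close> and to the left at \<open>z\<close>.
  The two would have a common vertex between \<open>x\<close> and \<open>z\<close> in
  \<open>P\<close>; being comparable with \<open>y\<close>, it would make \<open>y\<close>
  comparable with \<open>x\<close> or \<open>z\<close>.\<close>

lemma left_trans_incomparable:
  assumes xy: "left x y" and yz: "left y z" and xz: "x \<sqsubseteq> z \<or> z \<sqsubseteq> x"
  shows False
proof -
  have F: "x \<in> Field P" "y \<in> Field P" "z \<in> Field P" using left_Field[OF xy] left_Field[OF yz] by auto
  obtain C where C: "poset_maxchain P C" "x \<in> C" "z \<in> C" using comparable_maxchain[OF xz] by blast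
  obtain D where D: "poset_maxchain P D" "y \<in> D" using maxchain_containing[OF F(2)] by blast
  have "chain_at C (height x) < chain_at D (height x)"
    using leftD[OF xy C(1) D(1) C(2) D(2)] by simp
  moreover have "chain_at D (height z) < chain_at C (height z)"
    using leftD[OF yz D(1) C(1) D(2) C(3)] by simp
  ultimately obtain t where t: "t \<in> closed_segment (height x) (height z)" "chain_at C t = chain_at D t"
    using chain_at_crossing[OF C(1) D(1), OF height_range[OF F(1)] height_range[OF F(3)]] by auto
  then have "t \<in> {height bot..height top}" using closed_segment_heights[OF F(1,3)] by blast
  then obtain s where s: "s \<in> C" "s \<in> D" "height s \<le> t"
    and below: "\<And>w. w \<in> C \<union> D \<Longrightarrow> height w \<le> t \<Longrightarrow> w \<sqsubseteq> s"
    using chains_meet[OF C(1) D(1) _ t(2)] by blast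
  have "s \<sqsubseteq> y \<or> y \<sqsubseteq> s" using maxchain_comparable D s by blast
  moreover consider "height x \<le> t" "t \<le> height z" | "height z \<le> t" "t \<le> height x"
    using t by (auto simp: closed_segment_eq_real_ivl split: if_splits)
  then have "(x \<sqsubseteq> s \<and> s \<sqsubseteq> z) \<or> (z \<sqsubseteq> s \<and> s \<sqsubseteq> x)"
    using below C s maxchain_le_iff[OF C(1)] by cases auto
  ultimately show False
    using left_incomparable[OF xy] left_incomparable[OF yz] le_trans by blast
qed

text \<open>Look at the horizontal line through the element of middle height.\<close>

lemma left_no_cycle:
  assumes "left x y" "left y z" "left z x"
  shows False
proof -
  have mid: False if pm: "left p m" and ms: "left m s" and sp: "left s p" and hm: "height m \<in> closed_segment (height s) (height p)"
    for p m s
  proof -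
    obtain A where A: "poset_maxchain P A" "p \<in> A" using maxchain_containing[OF left_Field(1)[OF pm]] by blast
    obtain B where B: "poset_maxchain P B" "m \<in> B" using maxchain_containing[OF left_Field(1)[OF ms]] by blast
    obtain D where D: "poset_maxchain P D" "s \<in> D" using maxchain_containing[OF left_Field(1)[OF sp]] by blast
    have "chain_at A (height m) < chain_at B (height m)" using leftD[OF pm A(1) B(1)] A B by simp
    moreover have "chain_at B (height m) < chain_at D (height m)" using leftD[OF ms B(1) D(1)] B D by simp
    moreover have "chain_at D (height m) < chain_at A (height m)" using leftD[OF sp D(1) A(1)] A D hm by simp
    ultimately show False by simp
  qed
  have "height y \<in> closed_segment (height z) (height x) \<or> height z \<in> closed_segment (height x) (height y) \<or>
      height x \<in> closed_segment (height y) (height z)"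
    by (auto simp: closed_segment_eq_real_ivl)
  then show False using mid[of x y z] mid[of y z x] mid[of z x y] assms by blast
qed

lemma left_trans:
  assumes "left x y" "left y z" shows "left x z"
proof -
  have "left x z \<or> left z x"
    using left_total[OF left_Field(1)[OF assms(1)] left_Field(2)[OF assms(2)]]
      left_trans_incomparable[OF assms] by blast
  then show ?thesis using left_no_cycle[OF assms] by blast
qed

text \<open>Connects the chainwise order with the relation in condition (5). At the height of
  \<open>y\<close>, everything drawn on chains through \<open>x\<close> lies strictly left of
  \<open>f y\<close>, hence so do the horizontal segments between such points.\<close>

lemma left_imp_left_of:
  assumes "left x y" shows "left_of P f x y"
proof -
  obtain D where D: "poset_maxchain P D" "y \<in> D" using maxchain_containing[OF left_Field(2)[OF assms]] by blast
  have less: "fst p < fst (f y)"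
    if p: "p \<in> drawn_chains_through P f x" "snd p = height y" for p
  proof -
    obtain C where C: "poset_maxchain P C" "x \<in> C" "p \<in> drawn_chain P f C"
      using p by (auto simp: drawn_chains_through_def)
    then have "(fst p, height y) \<in> drawn_chain P f C" using p by (metis prod.collapse)
    then have "chain_at C (height y) = fst p" using chain_at_eq C by blast
    moreover have "chain_at C (height y) < chain_at D (height y)" using leftD[OF assms C(1) D(1)] C D by simp
    ultimately show ?thesis using chain_at_vertex D by simp
  qed
  have "f y \<notin> closed_segment p q"
    if "p \<in> drawn_chains_through P f x" "q \<in> drawn_chains_through P f x" "snd p = snd q" for p q
  proof
    assume "f y \<in> closed_segment p q"
    then obtain u where u: "0 \<le> u" "u \<le> 1" "f y = (1 - u) *\<^sub>R p + u *\<^sub>R q" by (auto simp: in_segment)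
    have "height y = (1 - u) * snd p + u * snd q" using u(3) by simp
    then have "height y = snd p" using that(3) by (simp add: algebra_simps)
    then have "fst p < fst (f y)" "fst q < fst (f y)" using less that by auto
    moreover have "fst (f y) = (1 - u) * fst p + u * fst q" using u by simp
    ultimately show False using u convex_bound_lt[of "fst p" "fst (f y)" "fst q" "1 - u" u] by simp
  qed
  moreover have "f y \<notin> drawn_chains_through P f x" using less by blast
  ultimately have "f y \<notin> chain_region P f x" by (auto simp: chain_region_def)
  moreover
  obtain C where C: "poset_maxchain P C" "x \<in> C" using maxchain_containing[OF left_Field(1)[OF assms]] by blast
  then have *: "(chain_at C (height y), height y) \<in> drawn_chains_through P f x"
    using chain_at_drawn[OF C(1) height_range[OF left_Field(2)[OF assms]]]
    by (auto simp: drawn_chains_through_def)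
  then have "chain_at C (height y) \<le> fst (f y)" using less by fastforce
  then have "(chain_at C (height y), height y) \<in> {(t, height y) | t. t \<le> fst (f y)} \<inter> chain_region P f x"
    using * by (auto simp: chain_region_def)
  ultimately show ?thesis unfolding left_of_def by blast
qed

text \<open>This is what makes \<open>P\<close> a lattice. With \<open>a\<close> left of
  \<open>d\<close> and \<open>u\<close> left of \<open>v\<close>, a chain through \<open>a\<close>
  and \<open>v\<close> and one through \<open>d\<close> and \<open>u\<close> change sides, so they
  meet, and a common vertex gives \<open>s\<close>. The other arrangements follow by
  renaming.\<close>

lemma interpolation:
  assumes "a \<sqsubseteq> u" "a \<sqsubseteq> v" "d \<sqsubseteq> u" "d \<sqsubseteq> v"
  shows "\<exists>s. a \<sqsubseteq> s \<and> d \<sqsubseteq> s \<and> s \<sqsubseteq> u \<and> s \<sqsubseteq> v"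
proof -
  have main: "\<exists>s. a \<sqsubseteq> s \<and> d \<sqsubseteq> s \<and> s \<sqsubseteq> u \<and> s \<sqsubseteq> v"
    if le: "a \<sqsubseteq> u" "a \<sqsubseteq> v" "d \<sqsubseteq> u" "d \<sqsubseteq> v" and ad: "left a d" and uv: "left u v" for a d u v
  proof -
    obtain C where C: "poset_maxchain P C" "a \<in> C" "v \<in> C" using comparable_maxchain le by blast
    obtain D where D: "poset_maxchain P D" "d \<in> D" "u \<in> D" using comparable_maxchain le by blast
    \<comment> \<open>A crossing between these heights is at or above both \<open>a\<close> and
      \<open>d\<close>, and at or below both \<open>u\<close> and \<open>v\<close>.\<close>
    define l r where "l = max (height a) (height d)" and "r = min (height u) (height v)"
    have lr: "l \<le> r" using le le_height by (auto simp: l_def r_def)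
    have "l \<in> closed_segment (height a) (height d)" "r \<in> closed_segment (height u) (height v)"
      by (auto simp: l_def r_def closed_segment_eq_real_ivl)
    then have "chain_at C l < chain_at D l" "chain_at D r < chain_at C r"
      using leftD[OF ad C(1) D(1)] leftD[OF uv D(1) C(1)] C D by auto
    moreover have "l \<in> {height bot..height top}" "r \<in> {height bot..height top}"
      using height_range le_Field le by (auto simp: l_def r_def max_def min_def)
    ultimately obtain t where t: "t \<in> closed_segment l r" "chain_at C t = chain_at D t"
      using chain_at_crossing[OF C(1) D(1), of l r] by fastforce
    then have tb: "l \<le> t" "t \<le> r" using lr by (auto simp: closed_segment_eq_real_ivl)
    then have "t \<in> {height bot..height top}"
      using \<open>l \<in> {height bot..height top}\<close> \<open>r \<in> {height bot..height top}\<close> by auto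
    then obtain s where s: "s \<in> C" "s \<in> D" "height s \<le> t"
      and below: "\<And>w. w \<in> C \<union> D \<Longrightarrow> height w \<le> t \<Longrightarrow> w \<sqsubseteq> s"
      using chains_meet[OF C(1) D(1) _ t(2)] by blast
    have "a \<sqsubseteq> s" "d \<sqsubseteq> s" using below C D tb by (auto simp: l_def)
    moreover have "s \<sqsubseteq> u" "s \<sqsubseteq> v"
      using maxchain_le_iff[OF C(1)] maxchain_le_iff[OF D(1)] C D s tb by (auto simp: r_def)
    ultimately show ?thesis by blast
  qed
  have F: "a \<in> Field P" "d \<in> Field P" "u \<in> Field P" "v \<in> Field P" using assms le_Field by blast+
  show ?thesis
  proof (cases "a \<sqsubseteq> d \<or> d \<sqsubseteq> a \<or> u \<sqsubseteq> v \<or> v \<sqsubseteq> u")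
    case True
    \<comment> \<open>The larger of \<open>a\<close>, \<open>d\<close> or the smaller of
      \<open>u\<close>, \<open>v\<close> serves as \<open>s\<close>.\<close>
    then show ?thesis using assms F le_refl by metis
  next
    case False
    then consider "left a d" "left u v" | "left d a" "left u v" | "left a d" "left v u" | "left d a" "left v u"
      using left_total F by blast
    then show ?thesis
      using main[of a u v d] main[of d u v a] main[of a v u d] main[of d v u a] assms by cases blast+
  qed
qed

end

section \<open>Labels of meets and joins\<close>

text \<open>Meets are given as a relation, so that existence is a separate matter and reversing
  \<open>P\<close> exchanges them with joins.\<close>

definition glb :: "nat rel \<Rightarrow> nat \<Rightarrow> nat \<Rightarrow> nat \<Rightarrow> bool" where
  "glb P x y m \<longleftrightarrow> (m, x) \<in> P \<and> (m, y) \<in> P \<and> (\<forall>z. (z, x) \<in> P \<and> (z, y) \<in> P \<longrightarrow> (z, m) \<in> P)"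

definition lub :: "nat rel \<Rightarrow> nat \<Rightarrow> nat \<Rightarrow> nat \<Rightarrow> bool" where
  "lub P x y j \<longleftrightarrow> (x, j) \<in> P \<and> (y, j) \<in> P \<and> (\<forall>z. (x, z) \<in> P \<and> (y, z) \<in> P \<longrightarrow> (j, z) \<in> P)"

lemma glb_converse: "glb (P\<inverse>) x y j \<longleftrightarrow> lub P x y j"
  by (simp add: glb_def lub_def)

text \<open>The order-theoretic content of the drawing, without geometry. The assumptions as a whole
  are invariant under reversing \<open>P\<close> with \<open>L\<close> unchanged; for this reason
  \<open>separating\<close> speaks about the labels of both ends of the interval.\<close>

locale planar_lattice = finite_poset +
  fixes L :: "nat \<Rightarrow> nat \<Rightarrow> bool"
  assumes L_Field: "L x y \<Longrightarrow> x \<in> Field P \<and> y \<in> Field P"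
    and L_incomparable: "L x y \<Longrightarrow> \<not> x \<sqsubseteq> y \<and> \<not> y \<sqsubseteq> x"
    and L_total: "x \<in> Field P \<Longrightarrow> y \<in> Field P \<Longrightarrow> \<not> x \<sqsubseteq> y \<Longrightarrow> \<not> y \<sqsubseteq> x \<Longrightarrow> L x y \<or> L y x"
    and L_trans: "L x y \<Longrightarrow> L y z \<Longrightarrow> L x z"
    and interpolate: "a \<sqsubseteq> u \<Longrightarrow> a \<sqsubseteq> v \<Longrightarrow> d \<sqsubseteq> u \<Longrightarrow> d \<sqsubseteq> v \<Longrightarrow>
      \<exists>s. a \<sqsubseteq> s \<and> d \<sqsubseteq> s \<and> s \<sqsubseteq> u \<and> s \<sqsubseteq> v"
    and lower_bound: "x \<in> Field P \<Longrightarrow> y \<in> Field P \<Longrightarrow> \<exists>z. z \<sqsubseteq> x \<and> z \<sqsubseteq> y"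
    and upper_bound: "x \<in> Field P \<Longrightarrow> y \<in> Field P \<Longrightarrow> \<exists>z. x \<sqsubseteq> z \<and> y \<sqsubseteq> z"
    and two_upper_covers: "x \<lessdot> a \<Longrightarrow> x \<lessdot> b \<Longrightarrow> x \<lessdot> c \<Longrightarrow> a = b \<or> a = c \<or> b = c"
    and two_lower_covers: "a \<lessdot> x \<Longrightarrow> b \<lessdot> x \<Longrightarrow> c \<lessdot> x \<Longrightarrow> a = b \<or> a = c \<or> b = c"
    and separating: "x \<sqsubseteq> y \<Longrightarrow> poset_disconnected P (open_interval P x y) \<Longrightarrow>
      C \<in> poset_components P (open_interval P x y) \<Longrightarrow>
      D \<in> poset_components P (open_interval P x y) \<Longrightarrow> C \<noteq> D \<Longrightarrow>
      w \<in> C \<Longrightarrow> z \<in> D \<Longrightarrow> L w z \<Longrightarrow> w < x \<and> x < z \<and> w < y \<and> y < z"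
begin

text \<open>Turning a drawing upside down keeps left and right. Facts about joins are obtained from
  those about meets in this way.\<close>

lemma planar_lattice_converse: "planar_lattice (P\<inverse>) L"
proof -
  interpret dual: finite_poset "P\<inverse>" by (rule finite_poset_converse)
  have interval: "open_interval (P\<inverse>) x y = open_interval P y x" for x y
    by (auto simp: open_interval_def poset_less_converse)
  have components: "poset_components (P\<inverse>) A = poset_components P A" for A
    by (simp add: poset_components_def Un_commute)
  show ?thesis
  proof unfold_locales
    fix x y C D w z
    assume "(x, y) \<in> P\<inverse>" "poset_disconnected (P\<inverse>) (open_interval (P\<inverse>) x y)"
      "C \<in> poset_components (P\<inverse>) (open_interval (P\<inverse>) x y)"
      "D \<in> poset_components (P\<inverse>) (open_interval (P\<inverse>) x y)" "C \<noteq> D" "w \<in> C" "z \<in> D" "L w z"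
    then show "w < x \<and> x < z \<and> w < y \<and> y < z"
      using separating[of y x C D w z] by (auto simp: interval components poset_disconnected_def)
  next
    fix a u v d
    assume "(a, u) \<in> P\<inverse>" "(a, v) \<in> P\<inverse>" "(d, u) \<in> P\<inverse>" "(d, v) \<in> P\<inverse>"
    then show "\<exists>s. (a, s) \<in> P\<inverse> \<and> (d, s) \<in> P\<inverse> \<and> (s, u) \<in> P\<inverse> \<and> (s, v) \<in> P\<inverse>"
      using interpolate[of u a d v] by auto
  next
    fix x y z
    assume "L x y" "L y z" then show "L x z" by (rule L_trans)
  next
    fix x a b c
    assume "poset_covers (P\<inverse>) x a" "poset_covers (P\<inverse>) x b" "poset_covers (P\<inverse>) x c"
    then show "a = b \<or> a = c \<or> b = c"
      using two_lower_covers[of a x b c] by (simp add: poset_covers_converse)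
  next
    fix x a b c
    assume "poset_covers (P\<inverse>) a x" "poset_covers (P\<inverse>) b x" "poset_covers (P\<inverse>) c x"
    then show "a = b \<or> a = c \<or> b = c"
      using two_upper_covers[of x a b c] by (simp add: poset_covers_converse)
  next
    fix x y assume "L x y"
    then show "x \<in> Field (P\<inverse>) \<and> y \<in> Field (P\<inverse>)" using L_Field by simp
  next
    fix x y assume "L x y"
    then show "(x, y) \<notin> P\<inverse> \<and> (y, x) \<notin> P\<inverse>" using L_incomparable[of x y] by simp
  next
    fix x y assume "x \<in> Field (P\<inverse>)" "y \<in> Field (P\<inverse>)" "(x, y) \<notin> P\<inverse>" "(y, x) \<notin> P\<inverse>"
    then show "L x y \<or> L y x" using L_total[of x y] by simp
  next
    fix x y assume "x \<in> Field (P\<inverse>)" "y \<in> Field (P\<inverse>)"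
    then show "\<exists>z. (z, x) \<in> P\<inverse> \<and> (z, y) \<in> P\<inverse>" using upper_bound[of x y] by simp
  next
    fix x y assume "x \<in> Field (P\<inverse>)" "y \<in> Field (P\<inverse>)"
    then show "\<exists>z. (x, z) \<in> P\<inverse> \<and> (y, z) \<in> P\<inverse>" using lower_bound[of x y] by simp
  qed
qed

text \<open>A maximal common lower bound \<open>m\<close> is the greatest one: interpolation with
  any other common lower bound yields a common lower bound above both, which must be
  \<open>m\<close> itself.\<close>

lemma glb_exists:
  assumes "x \<in> Field P" "y \<in> Field P" shows "\<exists>m. glb P x y m"
proof -
  let ?S = "{z. z \<sqsubseteq> x \<and> z \<sqsubseteq> y}"
  have "\<exists>m\<in>?S. \<forall>z\<in>?S. \<not> m \<sqsubset> z"
    by (rule exists_maximal) (use lower_bound[OF assms] le_Field in auto)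
  then obtain m where m: "m \<sqsubseteq> x" "m \<sqsubseteq> y" and max: "\<And>z. z \<sqsubseteq> x \<Longrightarrow> z \<sqsubseteq> y \<Longrightarrow> \<not> m \<sqsubset> z"
    by auto
  have "z \<sqsubseteq> m" if z: "z \<sqsubseteq> x" "z \<sqsubseteq> y" for z
  proof -
    obtain s where s: "m \<sqsubseteq> s" "z \<sqsubseteq> s" "s \<sqsubseteq> x" "s \<sqsubseteq> y" using interpolate[OF m z] by blast
    then have "s = m" using max[OF s(3,4)] by (auto simp: poset_less_def)
    then show ?thesis using s by simp
  qed
  then show ?thesis using m by (auto simp: glb_def)
qed

lemma lub_exists:
  assumes "x \<in> Field P" "y \<in> Field P" shows "\<exists>j. lub P x y j"
  using planar_lattice.glb_exists[OF planar_lattice_converse, of x y] assms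
  by (simp add: glb_converse)

text \<open>Otherwise \<open>L e b\<close>, and transitivity gives \<open>L e d\<close> against
  comparability. The relation can thus be moved along comparabilities in its right argument.\<close>

lemma L_right_comparable:
  assumes "L b d" "d \<sqsubseteq> e \<or> e \<sqsubseteq> d" "\<not> b \<sqsubseteq> e" "\<not> e \<sqsubseteq> b" shows "L b e"
proof -
  have "e \<in> Field P" using assms(2) by (auto intro: le_Field)
  then have "L b e \<or> L e b" using L_total[of b e] L_Field[OF assms(1)] assms(3,4) by blast
  moreover have "\<not> L e b" using L_incomparable[OF L_trans[OF _ assms(1)]] assms(2) by blast
  ultimately show ?thesis by blast
qed

lemma L_left_comparable:
  assumes "L b d" "b \<sqsubseteq> e \<or> e \<sqsubseteq> b" "\<not> d \<sqsubseteq> e" "\<not> e \<sqsubseteq> d" shows "L e d"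
proof -
  have "e \<in> Field P" using assms(2) by (auto intro: le_Field)
  then have "L d e \<or> L e d" using L_total[of d e] L_Field[OF assms(1)] assms(3,4) by blast
  moreover have "\<not> L d e" using L_incomparable[OF L_trans[OF assms(1)]] assms(2) by blast
  ultimately show ?thesis by blast
qed

text \<open>The open interval between an element and the join of two of its covers has two components,
  one above each cover.\<close>

lemma separating_covers:
  assumes b: "m \<lessdot> b" and d: "m \<lessdot> d" and "b \<noteq> d" and y: "lub P b d y"
    and u: "u \<in> open_interval P m y" "b \<sqsubseteq> u" and v: "v \<in> open_interval P m y" "d \<sqsubseteq> v"
    and "L u v"
  shows "u < m \<and> m < v \<and> u < y \<and> y < v"
proof -
  let ?A = "open_interval P m y"
  let ?R = "(Restr (P \<union> P\<inverse>) ?A)\<^sup>*"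
  have not_both: "\<not> (b \<sqsubseteq> s \<and> d \<sqsubseteq> s)" if "s \<in> ?A" for s
    using y that lt_not_le[of s y] unfolding lub_def open_interval_def by blast
  \<comment> \<open>A path from \<open>u\<close> stays above \<open>b\<close>: a step down to
    \<open>t\<close> ends above some cover of \<open>m\<close>, and this is not \<open>d\<close>,
    since otherwise \<open>s\<close> would lie above both \<open>b\<close> and
    \<open>d\<close>.\<close>
  have above_b: "b \<sqsubseteq> s" if "(u, s) \<in> ?R" for s
    using that
  proof (induction rule: rtrancl_induct)
    case base
    show ?case by (rule u)
  next
    case (step s t)
    then have st: "s \<in> ?A" "t \<in> ?A" "s \<sqsubseteq> t \<or> t \<sqsubseteq> s" by auto
    show ?case
    proof (cases "s \<sqsubseteq> t")
      case True
      then show ?thesis using step.IH le_trans by blast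
    next
      case False
      then have "t \<sqsubseteq> s" using st by blast
      have "m \<sqsubset> t" using st(2) by (simp add: open_interval_def)
      then obtain c where c: "m \<lessdot> c" "c \<sqsubseteq> t" using upper_cover by blast
      have "c \<noteq> d" using not_both[OF st(1)] step.IH le_trans[OF c(2) \<open>t \<sqsubseteq> s\<close>] by blast
      then have "c = b" using two_upper_covers[OF b d c(1)] \<open>b \<noteq> d\<close> by blast
      then show ?thesis using c by simp
    qed
  qed
  define C D where "C = ?R `` {u}" and "D = ?R `` {v}"
  have comp: "C \<in> poset_components P ?A" "D \<in> poset_components P ?A"
    using u v by (auto simp: C_def D_def poset_components_def intro: quotientI)
  have mem: "u \<in> C" "v \<in> D" by (auto simp: C_def D_def)
  have "v \<notin> C" using above_b not_both[OF v(1)] v(2) by (auto simp: C_def)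
  then have "C \<noteq> D" using mem by blast
  \<comment> \<open>Finiteness matters here because \<open>card\<close> is 0 on infinite
    sets.\<close>
  have "finite ?A" by (rule finite_subset_Field) (auto simp: open_interval_def intro: lt_Field)
  moreover have "poset_components P ?A = (\<lambda>s. ?R `` {s}) ` ?A"
    by (auto simp: poset_components_def quotient_def)
  ultimately have "finite (poset_components P ?A)" by simp
  then have "card {C, D} \<le> card (poset_components P ?A)" using comp by (intro card_mono) auto
  then have "poset_disconnected P ?A" using \<open>C \<noteq> D\<close> by (simp add: poset_disconnected_def)
  moreover have "m \<sqsubseteq> y" using u(1) lt_imp_le lt_trans by (auto simp: open_interval_def)
  ultimately show ?thesis using separating comp mem \<open>C \<noteq> D\<close> \<open>L u v\<close> by blast
qed

text \<open>Supplies the decreasing measure for an induction that passes to a strictly larger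
  meet.\<close>

lemma card_upset_less:
  assumes "m \<sqsubset> q" shows "card {z. q \<sqsubseteq> z} < card {z. m \<sqsubseteq> z}"
proof (rule psubset_card_mono)
  show "finite {z. m \<sqsubseteq> z}" by (rule finite_subset_Field) (auto intro: le_Field)
  have "{z. q \<sqsubseteq> z} \<subseteq> {z. m \<sqsubseteq> z}" using lt_imp_le[OF assms] le_trans by blast
  moreover have "m \<in> {z. m \<sqsubseteq> z} - {z. q \<sqsubseteq> z}"
    using lt_not_le[OF assms] le_refl[OF lt_Field(1)[OF assms]] by blast
  ultimately show "{z. q \<sqsubseteq> z} \<subset> {z. m \<sqsubseteq> z}" by blast
qed

text \<open>Let \<open>b'\<close> and \<open>d'\<close> be the covers of the meet below \<open>b\<close> and \<open>d\<close>, with join \<open>y\<close>. If \<open>b \<le> y\<close> then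
  \<open>b\<close> lies in the component of \<open>b'\<close>; otherwise descend to the pair \<open>b\<close>, \<open>y\<close>, whose meet lies in that
  component.\<close>

lemma label_glb_between:
  assumes "L b d" "glb P b d m" shows "b < m \<and> m < d"
  using assms
proof (induction "card {z. m \<sqsubseteq> z}" arbitrary: b d m rule: less_induct)
  case less
  note L = less.prems(1)
  have m: "m \<sqsubseteq> b" "m \<sqsubseteq> d" and greatest: "\<And>z. z \<sqsubseteq> b \<Longrightarrow> z \<sqsubseteq> d \<Longrightarrow> z \<sqsubseteq> m"
    using less.prems(2) by (auto simp: glb_def)
  have inc: "\<not> b \<sqsubseteq> d" "\<not> d \<sqsubseteq> b" using L_incomparable[OF L] by auto
  have F: "b \<in> Field P" "d \<in> Field P" using L_Field[OF L] by auto
  have "m \<sqsubset> b" "m \<sqsubset> d" using m inc by (auto simp: poset_less_def)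
  then obtain b' d' where b': "m \<lessdot> b'" "b' \<sqsubseteq> b" and d': "m \<lessdot> d'" "d' \<sqsubseteq> d"
    using upper_cover by blast
  have mb': "m \<sqsubset> b'" and md': "m \<sqsubset> d'" using b' d' covers_imp_lt by auto
  have nb: "\<not> b' \<sqsubseteq> d" using greatest[OF b'(2)] lt_not_le[OF mb'] by blast
  have nd: "\<not> d' \<sqsubseteq> b" using greatest[OF _ d'(2)] lt_not_le[OF md'] by blast
  have inc': "\<not> b' \<sqsubseteq> d'" "\<not> d' \<sqsubseteq> b'" "\<not> b \<sqsubseteq> d'" "\<not> d \<sqsubseteq> b'"
    using nb nd inc b'(2) d'(2) le_trans by blast+
  have Lbd': "L b d'" using L_right_comparable[OF L] d'(2) inc'(3) nd by blast
  have Lb'd: "L b' d" using L_left_comparable[OF L] b'(2) inc'(4) nb by blast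
  have Lb'd': "L b' d'" using L_left_comparable[OF Lbd'] b'(2) inc'(1,2) by blast
  have F': "b' \<in> Field P" "d' \<in> Field P" using L_Field[OF Lb'd'] by auto
  obtain y where y: "lub P b' d' y" using lub_exists[OF F'] by blast
  then have yub: "b' \<sqsubseteq> y" "d' \<sqsubseteq> y" by (auto simp: lub_def)
  have "b' \<noteq> d'" using inc' F' le_refl by blast
  note sep = separating_covers[OF b'(1) d'(1) this y]
  have b'_in: "b' \<in> open_interval P m y" and d'_in: "d' \<in> open_interval P m y"
    using mb' md' yub inc' by (auto simp: open_interval_def poset_less_def)
  have "b < m"
  proof (cases "b \<sqsubseteq> y")
    case True
    then have "b \<in> open_interval P m y"
      using \<open>m \<sqsubset> b\<close> nd yub by (auto simp: open_interval_def poset_less_def)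
    then show ?thesis using sep[OF _ b'(2) d'_in le_refl[OF F'(2)] Lbd'] by blast
  next
    case False
    have "\<not> y \<sqsubseteq> b" using yub nd le_trans by blast
    then have Lby: "L b y" using L_right_comparable[OF Lbd'] yub False by blast
    obtain q where q: "glb P b y q" using glb_exists F le_Field yub by blast
    then have qs: "q \<sqsubseteq> b" "q \<sqsubseteq> y" "b' \<sqsubseteq> q" using b' yub by (auto simp: glb_def)
    have "m \<sqsubset> q" using lt_le_trans[OF mb' qs(3)] .
    \<comment> \<open>The meet \<open>q\<close> of \<open>b\<close> and \<open>y\<close> is strictly
      above \<open>m\<close>, so induction applies; \<open>separating_covers\<close> for
      \<open>q\<close> and \<open>d'\<close> then gives \<open>q < m\<close>.\<close>
    have "b < q" using less.hyps[OF card_upset_less[OF \<open>m \<sqsubset> q\<close>] Lby q] by blast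
    moreover have "q \<in> open_interval P m y"
      using \<open>m \<sqsubset> q\<close> qs \<open>\<not> y \<sqsubseteq> b\<close> by (auto simp: open_interval_def poset_less_def)
    moreover have "L q d'"
    proof (rule L_left_comparable[OF Lbd'])
      show "b \<sqsubseteq> q \<or> q \<sqsubseteq> b" using qs by blast
      show "\<not> d' \<sqsubseteq> q" using nd qs le_trans by blast
      show "\<not> q \<sqsubseteq> d'" using inc'(1) qs le_trans by blast
    qed
    ultimately show ?thesis using sep[OF _ qs(3) d'_in le_refl[OF F'(2)]] by fastforce
  qed
  moreover have "m < d"
  proof (cases "d \<sqsubseteq> y")
    case True
    then have "d \<in> open_interval P m y"
      using \<open>m \<sqsubset> d\<close> nb yub by (auto simp: open_interval_def poset_less_def)
    then show ?thesis using sep[OF b'_in le_refl[OF F'(1)] _ d'(2) Lb'd] by blast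
  next
    case False
    have "\<not> y \<sqsubseteq> d" using yub nb le_trans by blast
    then have Lyd: "L y d" using L_left_comparable[OF Lb'd] yub False by blast
    obtain q where q: "glb P y d q" using glb_exists F le_Field yub by blast
    then have qs: "q \<sqsubseteq> y" "q \<sqsubseteq> d" "d' \<sqsubseteq> q" using d' yub by (auto simp: glb_def)
    have "m \<sqsubset> q" using lt_le_trans[OF md' qs(3)] .
    have "q < d" using less.hyps[OF card_upset_less[OF \<open>m \<sqsubset> q\<close>] Lyd q] by blast
    moreover have "q \<in> open_interval P m y"
      using \<open>m \<sqsubset> q\<close> qs \<open>\<not> y \<sqsubseteq> d\<close> by (auto simp: open_interval_def poset_less_def)
    moreover have "L b' q"
    proof (rule L_right_comparable[OF Lb'd])
      show "d \<sqsubseteq> q \<or> q \<sqsubseteq> d" using qs by blast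
      show "\<not> b' \<sqsubseteq> q" using nb qs le_trans by blast
      show "\<not> q \<sqsubseteq> b'" using inc'(2) qs le_trans by blast
    qed
    ultimately show ?thesis using sep[OF b'_in le_refl[OF F'(1)] _ qs(3)] by fastforce
  qed
  ultimately show ?case by blast
qed

lemma label_lub_between: "L b d \<Longrightarrow> lub P b d j \<Longrightarrow> b < j \<and> j < d"
  using planar_lattice.label_glb_between[OF planar_lattice_converse] by (simp add: glb_converse)

text \<open>The meet exists and its label lies strictly between the two.\<close>

lemma L_less:
  assumes "L b d" shows "b < d"
proof -
  obtain m where "glb P b d m" using glb_exists L_Field[OF assms] by blast
  then show ?thesis using label_glb_between[OF assms] by fastforce
qed

section \<open>The linear extension refining the left-to-right order\<close>

definition before :: "nat \<Rightarrow> nat \<Rightarrow> bool" where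
  "before x y \<longleftrightarrow> x \<sqsubset> y \<or> L x y"

lemma before_Field: "before x y \<Longrightarrow> x \<in> Field P \<and> y \<in> Field P"
  unfolding before_def using lt_Field L_Field by blast

lemma not_before_self: "\<not> before x x"
  using L_less by (auto simp: before_def poset_less_def)

text \<open>In the mixed cases \<open>z \<sqsubseteq> x\<close> would make the pair related by
  \<open>L\<close> comparable; if \<open>x\<close> and \<open>z\<close> are incomparable,
  \<open>L\<close> is transferred along the comparability.\<close>

lemma before_trans:
  assumes "before x y" "before y z" shows "before x z"
proof -
  have F: "x \<in> Field P" "y \<in> Field P" "z \<in> Field P" using assms before_Field by auto
  consider "x \<sqsubset> y" "y \<sqsubset> z" | "x \<sqsubset> y" "L y z" | "L x y" "y \<sqsubset> z" | "L x y" "L y z"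
    using assms by (auto simp: before_def)
  then show ?thesis
  proof cases
    case 1
    then show ?thesis using lt_trans by (auto simp: before_def)
  next
    case 2
    show ?thesis
    proof (cases "x \<sqsubseteq> z")
      case True
      moreover have "x \<noteq> z" using 2 L_incomparable lt_imp_le by blast
      ultimately show ?thesis by (simp add: before_def poset_less_def)
    next
      case False
      moreover have "\<not> z \<sqsubseteq> x" using 2 L_incomparable[OF 2(2)] le_trans lt_imp_le[OF 2(1)] by blast
      ultimately show ?thesis using L_left_comparable[OF 2(2)] lt_imp_le[OF 2(1)]
        by (auto simp: before_def)
    qed
  next
    case 3
    show ?thesis
    proof (cases "x \<sqsubseteq> z")
      case True
      moreover have "x \<noteq> z" using 3 L_incomparable lt_imp_le by blast
      ultimately show ?thesis by (simp add: before_def poset_less_def)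
    next
      case False
      moreover have "\<not> z \<sqsubseteq> x" using L_incomparable[OF 3(1)] le_trans lt_imp_le[OF 3(2)] by blast
      ultimately show ?thesis using L_right_comparable[OF 3(1)] lt_imp_le[OF 3(2)]
        by (auto simp: before_def)
    qed
  next
    case 4
    then show ?thesis using L_trans[OF 4] by (simp add: before_def)
  qed
qed

lemma before_total:
  "x \<in> Field P \<Longrightarrow> y \<in> Field P \<Longrightarrow> x \<noteq> y \<Longrightarrow> before x y \<or> before y x"
  using L_total[of x y] by (auto simp: before_def poset_less_def)

lemma sorted_list_exists:
  "finite S \<Longrightarrow> S \<subseteq> Field P \<Longrightarrow> \<exists>xs. set xs = S \<and> distinct xs \<and> sorted_wrt before xs"
proof (induction rule: finite_induct)
  case empty
  show ?case by simp
next
  case (insert x S)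
  then obtain xs where xs: "set xs = S" "distinct xs" "sorted_wrt before xs" by auto
  let ?ys = "filter (\<lambda>y. before y x) xs @ x # filter (\<lambda>y. before x y) xs"
  have "before y x \<or> before x y" if "y \<in> S" for y
    using before_total[of x y] that insert by auto
  moreover have "\<not> (before y x \<and> before x y)" for y
    using before_trans not_before_self by blast
  ultimately have "set ?ys = insert x S" "distinct ?ys"
    using xs insert.hyps by auto
  moreover have "sorted_wrt before ?ys"
    using xs before_trans by (auto simp: sorted_wrt_append sorted_wrt_filter)
  ultimately show ?case by blast
qed

section \<open>The increasing listing, twisted Baxter permutations and the greedy
  construction\<close>

definition increasing_listing :: "nat list \<Rightarrow> bool" where
  "increasing_listing \<sigma> \<longleftrightarrow> set \<sigma> = Field P \<and> distinct \<sigma> \<and> sorted_wrt before \<sigma>"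

lemma increasing_listing_exists: "\<exists>\<sigma>. increasing_listing \<sigma>"
  using sorted_list_exists[OF finite_Field] by (auto simp: increasing_listing_def)

lemma increasing_listing_nth_before:
  assumes \<sigma>: "increasing_listing \<sigma>" and pq: "p < length \<sigma>" "q < length \<sigma>"
  shows "before (\<sigma> ! p) (\<sigma> ! q) \<longleftrightarrow> p < q"
proof -
  have mono: "before (\<sigma> ! i) (\<sigma> ! j)" if "i < j" "j < length \<sigma>" for i j
    using \<sigma> that by (simp add: increasing_listing_def sorted_wrt_nth_less)
  show ?thesis
  proof
    assume b: "before (\<sigma> ! p) (\<sigma> ! q)"
    show "p < q"
    proof (rule ccontr)
      assume "\<not> p < q"
      then have "p = q \<or> before (\<sigma> ! q) (\<sigma> ! p)" using mono[of q p] pq(1) by linarith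
      then show False using b before_trans not_before_self by metis
    qed
  qed (use mono pq in blast)
qed

lemma increasing_listing_index:
  assumes "increasing_listing \<sigma>" "x \<in> Field P"
  shows "\<exists>p<length \<sigma>. \<sigma> ! p = x"
  using assms by (auto simp: increasing_listing_def in_set_conv_nth)

lemma increasing_listing_linear_extension:
  assumes \<sigma>: "increasing_listing \<sigma>" shows "linear_extension P \<sigma>"
  unfolding linear_extension_def
proof (intro conjI allI impI)
  show "\<sigma> \<in> permutations_of_set (Field P)"
    using \<sigma> by (auto simp: increasing_listing_def permutations_of_set_def)
  fix x y assume xy: "x \<sqsubset> y"
  then have "x \<in> Field P" "y \<in> Field P" using lt_Field by auto
  then obtain i j where ij: "i < length \<sigma>" "\<sigma> ! i = x" "j < length \<sigma>" "\<sigma> ! j = y"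
    using increasing_listing_index[OF \<sigma>] by blast
  have "i < j" using increasing_listing_nth_before[OF \<sigma> ij(1,3)] ij xy by (simp add: before_def)
  then show "\<exists>i j. i < j \<and> j < length \<sigma> \<and> \<sigma> ! i = x \<and> \<sigma> ! j = y" using ij by blast
qed

text \<open>Since \<open>L\<close> increases labels, a descent in adjacent positions is a relation
  of \<open>P\<close>, and adjacency makes it a cover. The labels of joins and meets then force the
  outer entries of the pattern below and above this cover, which gives an excluded chain.\<close>

lemma increasing_listing_twisted_Baxter:
  assumes \<sigma>: "increasing_listing \<sigma>" and Field: "Field P = {1..n}"
    and no_chain: "\<And>a b c d. a < b \<Longrightarrow> b < c \<Longrightarrow> c < d \<Longrightarrow>
      \<not> chain_2_41_3 P a b c d \<and> \<not> chain_3_41_2 P a b c d"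
  shows "twisted_Baxter n \<sigma>"
proof -
  have perm: "\<sigma> \<in> permutations_of_set {1..n}"
    using \<sigma> Field by (auto simp: increasing_listing_def permutations_of_set_def)
  then have len: "length \<sigma> = n" using length_finite_permutations_of_set by fastforce
  note bef = increasing_listing_nth_before[OF \<sigma>]
  \<comment> \<open>The inequalities shared by the two forbidden patterns, which differ only in the
    order of the outer entries.\<close>
  have False if ijk: "i < j" "j + 1 < k" "k < n"
    and pat: "\<sigma> ! (j + 1) < \<sigma> ! i" "\<sigma> ! (j + 1) < \<sigma> ! k" "\<sigma> ! i < \<sigma> ! j" "\<sigma> ! k < \<sigma> ! j"
    for i j k
  proof -
    define a d e g where "a = \<sigma> ! (j + 1)" and "d = \<sigma> ! j" and "e = \<sigma> ! i" and "g = \<sigma> ! k"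
    note defs = a_def d_def e_def g_def
    have less: "a < e" "a < g" "e < d" "g < d" using pat by (auto simp: defs)
    have "before d a" "before e d" "before a g"
      using bef ijk len by (auto simp: defs)
    then have da: "d \<sqsubset> a" using L_less[of d a] less by (auto simp: before_def)
    have cover: "d \<lessdot> a"
    proof -
      have False if "d \<sqsubset> z" "z \<sqsubset> a" for z
      proof -
        obtain r where r: "r < length \<sigma>" "\<sigma> ! r = z"
          using increasing_listing_index[OF \<sigma>] lt_Field \<open>d \<sqsubset> z\<close> by blast
        have "before (\<sigma> ! j) (\<sigma> ! r)" "before (\<sigma> ! r) (\<sigma> ! (j + 1))"
          using that r by (auto simp: before_def defs)
        then have "j < r" "r < j + 1" using bef r(1) ijk len by auto
        then show False by simp
      qed
      then show ?thesis using da unfolding poset_covers_def by blast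
    qed
    \<comment> \<open>If \<open>e\<close> were left of \<open>d\<close>, their join would be
      \<open>a\<close>, whose label would have to lie between theirs, but
      \<open>a < e\<close>.\<close>
    have ed: "e \<sqsubset> d"
    proof (rule ccontr)
      assume "\<not> e \<sqsubset> d"
      then have Led: "L e d" using \<open>before e d\<close> by (auto simp: before_def)
      have "before e a" using before_trans \<open>before e d\<close> \<open>before d a\<close> by blast
      then have "e \<sqsubset> a" using L_less[of e a] less by (auto simp: before_def)
      obtain j where j: "lub P e d j" using lub_exists L_Field[OF Led] by blast
      then have le: "e \<sqsubseteq> j" "d \<sqsubseteq> j" "j \<sqsubseteq> a"
        using \<open>e \<sqsubset> a\<close> da lt_imp_le by (auto simp: lub_def)
      have "d \<sqsubset> j" using le L_incomparable[OF Led] by (auto simp: poset_less_def)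
      then have "j = a" using cover le unfolding poset_covers_def poset_less_def by blast
      then show False using label_lub_between[OF Led j] less by simp
    qed
    \<comment> \<open>Dually, the meet of \<open>a\<close> and \<open>g\<close> would be
      \<open>d\<close>, whose label exceeds both.\<close>
    have ag: "a \<sqsubset> g"
    proof (rule ccontr)
      assume "\<not> a \<sqsubset> g"
      then have Lag: "L a g" using \<open>before a g\<close> by (auto simp: before_def)
      have "before d g" using before_trans \<open>before a g\<close> \<open>before d a\<close> by blast
      then have "d \<sqsubset> g" using L_less[of d g] less by (auto simp: before_def)
      obtain m where m: "glb P a g m" using glb_exists L_Field[OF Lag] by blast
      then have le: "m \<sqsubseteq> a" "m \<sqsubseteq> g" "d \<sqsubseteq> m"
        using \<open>d \<sqsubset> g\<close> da lt_imp_le by (auto simp: glb_def)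
      have "m \<sqsubset> a" using le L_incomparable[OF Lag] by (auto simp: poset_less_def)
      then have "m = d" using cover le unfolding poset_covers_def poset_less_def by blast
      then show False using label_glb_between[OF Lag m] less by simp
    qed
    have "e \<noteq> g" using lt_trans[OF lt_trans[OF ed da] ag] by (auto simp: poset_less_def)
    then consider "e < g" | "g < e" by linarith
    then show False
    proof cases
      case 1
      then show False using no_chain[of a e g d] less ed cover ag by (simp add: chain_2_41_3_def)
    next
      case 2
      then show False using no_chain[of a g e d] less ed cover ag by (simp add: chain_3_41_2_def)
    qed
  qed
  then show ?thesis
    unfolding twisted_Baxter_def using perm by (meson order.strict_trans)
qed

text \<open>As \<open>before\<close> is transitive, adjacent entries suffice. At a wrongly ordered
  adjacent pair, the meet stands before it and the join after it, both with labels between; the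
  numerical order of meet and join decides which forbidden pattern appears.\<close>

lemma twisted_Baxter_increasing_listing:
  assumes lin: "linear_extension P \<sigma>" and twisted: "twisted_Baxter n \<sigma>" and Field: "Field P = {1..n}"
  shows "increasing_listing \<sigma>"
proof -
  have perm: "set \<sigma> = Field P" "distinct \<sigma>"
    using lin by (auto simp: linear_extension_def permutations_of_set_def)
  then have len: "length \<sigma> = n" using Field distinct_card by fastforce
  have index_less: "p < q"
    if lt: "\<sigma> ! p \<sqsubset> \<sigma> ! q" and pq: "p < length \<sigma>" "q < length \<sigma>" for p q
  proof -
    obtain i j where ij: "i < j" "j < length \<sigma>" "\<sigma> ! i = \<sigma> ! p" "\<sigma> ! j = \<sigma> ! q"
      using lin lt unfolding linear_extension_def by blast
    then have "i = p" "j = q"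
      using nth_eq_iff_index_eq[OF perm(2), of i p] nth_eq_iff_index_eq[OF perm(2), of j q] pq by auto
    then show ?thesis using ij by simp
  qed
  have adjacent: "before (\<sigma> ! i) (\<sigma> ! Suc i)" if i: "Suc i < length \<sigma>" for i
  proof (rule ccontr)
    assume not: "\<not> ?thesis"
    have F: "\<sigma> ! i \<in> Field P" "\<sigma> ! Suc i \<in> Field P"
      using nth_mem[of i \<sigma>] nth_mem[of "Suc i" \<sigma>] i unfolding perm(1) by simp_all
    have "\<sigma> ! i \<noteq> \<sigma> ! Suc i" using perm(2) i nth_eq_iff_index_eq[of \<sigma> i "Suc i"] by simp
    then have "before (\<sigma> ! Suc i) (\<sigma> ! i)" using before_total F not by blast
    \<comment> \<open>A linear extension respects \<open>P\<close>, so the wrong order can only come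
      from \<open>L\<close>.\<close>
    moreover have "\<not> \<sigma> ! Suc i \<sqsubset> \<sigma> ! i" using index_less[of "Suc i" i] i by auto
    ultimately have L: "L (\<sigma> ! Suc i) (\<sigma> ! i)" by (simp add: before_def)
    note inc = L_incomparable[OF L]
    obtain m j where m: "glb P (\<sigma> ! Suc i) (\<sigma> ! i) m" and j: "lub P (\<sigma> ! Suc i) (\<sigma> ! i) j"
      using glb_exists lub_exists F by blast
    have mi: "m \<sqsubset> \<sigma> ! i" and ij: "\<sigma> ! Suc i \<sqsubset> j"
      using m j inc by (auto simp: glb_def lub_def poset_less_def)
    obtain p where p: "p < length \<sigma>" "\<sigma> ! p = m"
      using lt_Field(1)[OF mi] unfolding perm(1)[symmetric] in_set_conv_nth by blast
    obtain q where q: "q < length \<sigma>" "\<sigma> ! q = j"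
      using lt_Field(2)[OF ij] unfolding perm(1)[symmetric] in_set_conv_nth by blast
    have "p < i" using index_less[of p i] mi p i by simp
    moreover have "i + 1 < q" using index_less[of "Suc i" q] ij q i by simp
    moreover have "m \<sqsubset> j" using lt_le_trans[OF mi] j by (simp add: lub_def)
    then have "m < j \<or> j < m" by (auto simp: poset_less_def)
    moreover note label_glb_between[OF L m] label_lub_between[OF L j]
    ultimately have "\<exists>i j k. i < j \<and> j + 1 < k \<and> k < n \<and>
        (\<sigma> ! (j + 1) < \<sigma> ! i \<and> \<sigma> ! i < \<sigma> ! k \<and> \<sigma> ! k < \<sigma> ! j \<or>
         \<sigma> ! (j + 1) < \<sigma> ! k \<and> \<sigma> ! k < \<sigma> ! i \<and> \<sigma> ! i < \<sigma> ! j)"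
      using p q len by (intro exI[of _ p] exI[of _ i] exI[of _ q]) auto
    then show False using twisted unfolding twisted_Baxter_def by blast
  qed
  have "transp before" using before_trans by (auto simp: transp_def)
  then have "sorted_wrt before \<sigma>" using adjacent by (simp add: sorted_wrt_iff_nth_Suc_transp)
  then show ?thesis using perm by (simp add: increasing_listing_def)
qed

text \<open>Prefixes of the listing are order ideals, so the next entry is a candidate. Any other
  candidate comes later but is not above it in \<open>P\<close>; hence it is to the right and has a
  larger label.\<close>

lemma increasing_listing_greedy:
  assumes \<sigma>: "increasing_listing \<sigma>" and Field: "Field P = {1..n}"
  shows "greedy_construction n P \<sigma>"
proof -
  have set: "set \<sigma> = Field P" and dist: "distinct \<sigma>" using \<sigma> by (auto simp: increasing_listing_def)
  then have len: "length \<sigma> = n" using Field distinct_card by fastforce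
  note bef = increasing_listing_nth_before[OF \<sigma>]
  have ideal: "order_ideal P (set (take k \<sigma>))" for k
    unfolding order_ideal_def
  proof (intro conjI allI impI)
    show "set (take k \<sigma>) \<subseteq> Field P" using set set_take_subset by fastforce
    fix a b assume ab: "a \<in> set (take k \<sigma>) \<and> b \<sqsubset> a"
    then obtain p where p: "p < k" "p < length \<sigma>" "a = \<sigma> ! p" by (auto simp: in_set_conv_nth)
    obtain q where q: "q < length \<sigma>" "\<sigma> ! q = b"
      using increasing_listing_index[OF \<sigma>] lt_Field ab by blast
    have "q < p" using bef[OF q(1) p(2)] ab p q by (simp add: before_def)
    then have "take k \<sigma> ! q = b" "q < length (take k \<sigma>)" using p q by auto
    then show "b \<in> set (take k \<sigma>)" using nth_mem by metis
  qed
  have step: "\<sigma> ! k \<in> next_candidates P (take k \<sigma>) \<and>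
      Min (next_candidates P (take k \<sigma>)) = \<sigma> ! k" if k: "k < n" for k
  proof -
    have kl: "k < length \<sigma>" using k len by simp
    have snoc: "take k \<sigma> @ [\<sigma> ! k] = take (Suc k) \<sigma>" using kl by (simp add: take_Suc_conv_app_nth)
    have notin: "\<sigma> ! k \<notin> set (take k \<sigma>)"
      using dist distinct_take[of \<sigma> "Suc k"] by (simp flip: snoc)
    have "partial_linear_extension P (take (Suc k) \<sigma>)"
      unfolding partial_linear_extension_def
      using dist set ideal set_take_subset[of "Suc k" \<sigma>] by (auto simp: min_def)
    moreover have "\<sigma> ! k \<in> Field P" using nth_mem[OF kl] unfolding set .
    ultimately have mem: "\<sigma> ! k \<in> next_candidates P (take k \<sigma>)"
      using notin by (simp add: next_candidates_def snoc)
    have least: "\<sigma> ! k \<le> u" if u: "u \<in> next_candidates P (take k \<sigma>)" for u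
    proof (cases "u = \<sigma> ! k")
      case False
      have uF: "u \<in> Field P" and ux: "u \<notin> set (take k \<sigma>)"
        and ext: "partial_linear_extension P (take k \<sigma> @ [u])"
        using u by (auto simp: next_candidates_def)
      obtain r where r: "r < length \<sigma>" "\<sigma> ! r = u" using increasing_listing_index[OF \<sigma> uF] by blast
      have "\<not> r < k"
      proof
        assume "r < k"
        then have "take k \<sigma> ! r = u" "r < length (take k \<sigma>)" using r by auto
        then show False using ux nth_mem by metis
      qed
      then have "before (\<sigma> ! k) u" using bef[OF kl r(1)] False r by (metis linorder_neqE_nat)
      moreover have "\<not> \<sigma> ! k \<sqsubset> u"
      proof
        assume lt: "\<sigma> ! k \<sqsubset> u"
        \<comment> \<open>The ideal condition of a partial linear extension at the prefix of full
          length.\<close>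
        have "order_ideal P (set (take (length (take k \<sigma> @ [u])) (take k \<sigma> @ [u])))"
          using ext unfolding partial_linear_extension_def by fastforce
        then have "order_ideal P (insert u (set (take k \<sigma>)))"
          unfolding take_all_iff[THEN iffD2, OF order_refl] by simp
        then have "\<sigma> ! k \<in> insert u (set (take k \<sigma>))" using lt unfolding order_ideal_def by blast
        then show False using notin False by simp
      qed
      ultimately show ?thesis using L_less[of "\<sigma> ! k" u] by (auto simp: before_def)
    qed simp
    have "finite (next_candidates P (take k \<sigma>))"
      using finite_Field by (simp add: next_candidates_def)
    then show ?thesis using mem least by (auto intro: Min_eqI)
  qed
  show ?thesis
    unfolding greedy_construction_def
  proof (intro conjI ballI)
    fix i assume "i \<in> {1..n}"
    then have "i - 1 < n" by auto
    from step[OF this] show "next_candidates P (take (i - 1) \<sigma>) \<noteq> {}"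
      "\<sigma> ! (i - 1) = Min (next_candidates P (take (i - 1) \<sigma>))" by auto
  qed (rule len)
qed

end

text \<open>Each entry is determined by the prefix before it, so the prefixes agree by
  induction.\<close>

lemma greedy_construction_unique:
  assumes "greedy_construction n P \<sigma>" "greedy_construction n P \<tau>" shows "\<sigma> = \<tau>"
proof -
  have len: "length \<sigma> = n" "length \<tau> = n" using assms by (auto simp: greedy_construction_def)
  \<comment> \<open>Positions count from 0, so entry \<open>k\<close> is produced at step
    \<open>Suc k\<close>.\<close>
  have nth: "\<rho> ! k = Min (next_candidates P (take k \<rho>))" if "greedy_construction n P \<rho>" "k < n" for \<rho> k
    using that unfolding greedy_construction_def by (auto dest!: bspec[of _ _ "Suc k"])
  have "take k \<sigma> = take k \<tau>" if "k \<le> n" for k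
    using that
  proof (induction k)
    case (Suc k)
    then show ?case using len nth[OF assms(1), of k] nth[OF assms(2), of k]
      by (simp add: take_Suc_conv_app_nth)
  qed simp
  from this[of n] show ?thesis using len by simp
qed

section \<open>From Baxter posets to planar lattices, and the theorem\<close>

lemma card_le_2_eq:
  assumes "card S \<le> 2" "finite S" "a \<in> S" "b \<in> S" "c \<in> S"
  shows "a = b \<or> a = c \<or> b = c"
proof (rule ccontr)
  assume "\<not> ?thesis"
  then have "card {a, b, c} = 3" by auto
  moreover have "card {a, b, c} \<le> card S" using assms by (intro card_mono) auto
  ultimately show False using assms by simp
qed

lemma poset_components_subset: "C \<in> poset_components P A \<Longrightarrow> C \<subseteq> A"
  unfolding poset_components_def by (erule quotientE) (auto elim: rtranclE)

text \<open>The geometric relation \<open>left\<close> serves as \<open>L\<close>; boundedness and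
  conditions (2), (4) and (5) supply what does not come from the drawing alone.\<close>

lemma Baxter_poset_planar_lattice:
  assumes Baxter: "Baxter_poset n P"
  shows "\<exists>L. planar_lattice P L"
proof -
  have order: "partial_order_on {1..n} P" using Baxter by (simp add: Baxter_poset_def)
  then have Field: "Field P = {1..n}"
    by (auto simp: partial_order_on_def preorder_on_def refl_on_def Field_def)
  interpret finite_poset P using order Field by unfold_locales auto
  obtain bot top where "bot \<in> Field P" "\<forall>x\<in>Field P. bot \<sqsubseteq> x" "top \<in> Field P" "\<forall>x\<in>Field P. x \<sqsubseteq> top"
    using Baxter by (auto simp: Baxter_poset_def poset_bounded_def)
  moreover obtain f where "planar_embedding P f"
    and f: "\<forall>x y. x \<sqsubseteq> y \<and> poset_disconnected P (open_interval P x y) \<longrightarrow>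
      (\<forall>C\<in>poset_components P (open_interval P x y).
       \<forall>D\<in>poset_components P (open_interval P x y). C \<noteq> D \<longrightarrow>
         (\<forall>w\<in>C. \<forall>z\<in>D. left_of P f w z \<longrightarrow> w < x \<and> x < z))"
    using Baxter unfolding Baxter_poset_def by (elim conjE exE)
  ultimately interpret drawn_poset P f bot top by unfold_locales auto
  have consecutive: "\<bar>int x - int y\<bar> = 1"
    if "x \<sqsubseteq> y" "poset_disconnected P (open_interval P x y)" for x y
    using Baxter that by (simp add: Baxter_poset_def)
  have few: "card {y. x \<lessdot> y} \<le> 2" "card {y. y \<lessdot> x} \<le> 2" if "x \<in> Field P" for x
    using Baxter that by (simp_all add: Baxter_poset_def Field)
  have "planar_lattice P left"
  proof unfold_locales
    fix x y C D w z
    assume *: "x \<sqsubseteq> y" "poset_disconnected P (open_interval P x y)"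
      "C \<in> poset_components P (open_interval P x y)" "D \<in> poset_components P (open_interval P x y)"
      "C \<noteq> D" and wz: "w \<in> C" "z \<in> D" "left w z"
    have "w < x \<and> x < z" using f * wz(1,2) left_imp_left_of[OF wz(3)] by simp
    \<comment> \<open>Condition (5) bounds the label of \<open>x\<close>. By (4) the label of
      \<open>y\<close> is adjacent to it, and \<open>y\<close> differs from \<open>w\<close> and
      \<open>z\<close>, so it lies between them as well.\<close>
    moreover have "w \<noteq> y" "z \<noteq> y"
      using poset_components_subset *(3,4) wz(1,2) by (auto simp: open_interval_def poset_less_def)
    ultimately show "w < x \<and> x < z \<and> w < y \<and> y < z" using consecutive[OF *(1,2)] by linarith
  next
    fix x a b c assume "x \<lessdot> a" "x \<lessdot> b" "x \<lessdot> c"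
    moreover from this have "x \<in> Field P" "finite {y. x \<lessdot> y}"
      by (auto dest: covers_imp_lt lt_Field intro: finite_subset_Field)
    ultimately show "a = b \<or> a = c \<or> b = c" using card_le_2_eq[OF few(1)] by simp
  next
    fix x a b c assume "a \<lessdot> x" "b \<lessdot> x" "c \<lessdot> x"
    moreover from this have "x \<in> Field P" "finite {y. y \<lessdot> x}"
      by (auto dest: covers_imp_lt lt_Field intro: finite_subset_Field)
    ultimately show "a = b \<or> a = c \<or> b = c" using card_le_2_eq[OF few(2)] by simp
  next
    fix x y assume "left x y"
    then show "x \<in> Field P \<and> y \<in> Field P" "\<not> x \<sqsubseteq> y \<and> \<not> y \<sqsubseteq> x"
      by (simp_all add: left_Field left_incomparable)
  next
    fix x y assume "x \<in> Field P" "y \<in> Field P"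
    then show "\<exists>z. z \<sqsubseteq> x \<and> z \<sqsubseteq> y" "\<exists>z. x \<sqsubseteq> z \<and> y \<sqsubseteq> z"
      using bot top by blast+
  qed (fact left_total left_trans interpolation)+
  then show ?thesis by blast
qed

theorem theorem5p1:
  fixes n :: nat and P :: "nat rel"
  assumes "Baxter_poset n P"
  shows "(\<exists>!\<sigma>. twisted_Baxter n \<sigma> \<and> linear_extension P \<sigma>) \<and>
         (\<forall>\<sigma>. twisted_Baxter n \<sigma> \<and> linear_extension P \<sigma> \<longleftrightarrow> greedy_construction n P \<sigma>)"
proof -
  obtain L where "planar_lattice P L" using Baxter_poset_planar_lattice[OF assms] by blast
  then interpret planar_lattice P L .
  have Field: "Field P = {1..n}"
    using assms by (auto simp: Baxter_poset_def partial_order_on_def preorder_on_def refl_on_def Field_def)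
  have no_chain: "\<not> chain_2_41_3 P a b c d \<and> \<not> chain_3_41_2 P a b c d"
    if "a < b" "b < c" "c < d" for a b c d
  proof (cases "{a, b, c, d} \<subseteq> {1..n}")
    case True
    then show ?thesis using assms that by (simp add: Baxter_poset_def)
  next
    case False
    \<comment> \<open>All elements of a chain belong to the field, so labels outside
      \<open>{1..n}\<close> form no chain.\<close>
    then show ?thesis
      using lt_Field Field unfolding chain_2_41_3_def chain_3_41_2_def poset_covers_def by blast
  qed
  have twisted: "twisted_Baxter n \<sigma> \<and> linear_extension P \<sigma> \<longleftrightarrow> increasing_listing \<sigma>" for \<sigma>
    using twisted_Baxter_increasing_listing[OF _ _ Field] increasing_listing_linear_extension
      increasing_listing_twisted_Baxter[OF _ Field no_chain] by blast
  obtain \<tau> where \<tau>: "increasing_listing \<tau>" using increasing_listing_exists by blast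
  \<comment> \<open>For the converse, a greedy word equals \<open>\<tau>\<close> because both are
    greedy.\<close>
  have "increasing_listing \<sigma> \<longleftrightarrow> greedy_construction n P \<sigma>" for \<sigma>
    using increasing_listing_greedy[OF _ Field] greedy_construction_unique \<tau> by metis
  then show ?thesis unfolding twisted using \<tau> greedy_construction_unique by metis
qed

end
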